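(* Let $\pi_1:(P_1,\Sigma_1)\to(Q,\Sigma)$ and $\pi_2:(P_2,\Sigma_2)\to(Q,\Sigma)$ be morphisms in the category $\mathcal{P}$, where $(P_1,\Sigma_1)$ and $(P_2,\Sigma_2)$ are flag and $(Q,\Sigma)$ has unique standard monomials. Let $k_1,k_2\ge 2$ be integers such that, for $i=1,2$, the standard relations of $(P_i,\Sigma_i)$ are generated by standard relations of degree at most $k_i$. Then the ideal $I_{P_1\times_QP_2}$ of the fiber product $(P_1,\Sigma_1)\times_{(Q,\Sigma)}(P_2,\Sigma_2)$ is generated in degree at most $\max\{k_1,k_2\}$.
   Context: For a lattice polytope $P\subset\mathbb{R}^n$, $X_P$ is its set of lattice points, $\mathbb{C}[X_P]$ is the polynomial ring with one variable per lattice point, $mP$ is the $m$-fold Minkowski sum, and $\mathbb{C}[P]$ is the graded algebra whose $m$-th graded component has as basis the lattice points of $mP$, with product given by addition. $I_P$ is the kernel of $\mathbb{C}[X_P]\to\mathbb{C}[P]$. A term order on $P$ is a function $\Sigma:X_P\to\mathbb{R}$. For a monomial $x^{\mathbf m}=x_1^{m_1}\cdots x_k^{m_k}$ put $\Sigma(\mathbf m)=\sum_i m_i\Sigma(x_i)$; monomials are (partially) ordered first by degree and then by the value of $\Sigma$. A monomial is standard if it is not the initial form (sum of largest terms) of any polynomial in $I_P$. Equivalently, for a lattice point $b\in mP$ let $\Delta_b$ be the set of degree $m$ monomials of $\mathbb{C}[X_P]$ mapping to $b$; the standard monomials in $\Delta_b$ are those with minimal $\Sigma$-value. $(P,\Sigma)$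 has unique standard monomials if each non-empty $\Delta_b$ has a unique minimal element. $(P,\Sigma)$ is flag if a monomial is standard if and only if each of its degree $2$ divisors is standard, and $x^n$ is standard for every $x\in X_P$ and every $n$. The simplicial complex $\Delta_\Sigma(P)$ on $X_P$ has as faces the sets $S\subset X_P$ such that every monomial with support $S$ is standard. For flag $(P,\Sigma)$ the standard regions of $P$ are the convex hulls of the maximal faces of $\Delta_\Sigma(P)$; the lattice points in a region are exactly the elements of the corresponding maximal face. A binomial $x^{\mathbf n}-x^{\mathbf m}\in I_P$ is a standard relation if both monomials are composed of lattice points from the same standard region. The category $\mathcal{P}$ has as objects pairs $(P,\Sigma)$ of a lattice polytope and a term order on it; a morphism $\pi:(P,\Sigma)\to(Q,\Gamma)$ is a linear map $P\to Q$, induced by a map on lattices, taking standard monomials of $\Sigma$ to standard monomials of $\Gamma$. Under the hypothesis on $(Q,\Sigma)$, the fiber product $(P_1,\Sigma_1)\times_{(Q,\Sigma)}(P_2,\Sigma_2)$ in $\mathcal{P}$ is the polytope $P_1\times_QP_2=\{(x,y)\in P_1\times P_2:\pi_1(x)=\pi_2(y)\}$ with term order $(\Sigma_1\oplus\Sigma_2)(u,v)=\Sigma_1(u)+\Sigma_2(v)$. *)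

theory Defs
  imports
    "HOL-Analysis.Analysis"
    "HOL-Algebra.RingHom"
    "HOL-Library.Poly_Mapping"
begin

section \<open>Lattice polytopes\<close>

text \<open>
  \<open>\<real>\<^sup>n\<close> is any Euclidean space, with the points of integral coordinates as its lattice. This covers
  both \<open>real ^ 'n\<close> and the product type \<open>'a \<times> 'b\<close> in which fiber products live; the lattice of
  the latter is the product of the two lattices.
\<close>

definition int_lattice :: "'a::euclidean_space set" where
  "int_lattice = {x. \<forall>b\<in>Basis. x \<bullet> b \<in> \<int>}"

definition lattice_polytope :: "'a::euclidean_space set \<Rightarrow> bool" where
  "lattice_polytope P \<longleftrightarrow> (\<exists>V. finite V \<and> V \<subseteq> int_lattice \<and> P = convex hull V)"

definition lattice_points :: "'a::euclidean_space set \<Rightarrow> 'a set" where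
  "lattice_points P = P \<inter> int_lattice"

text \<open>The empty Minkowski sum is \<open>{0}\<close>.\<close>

definition dilate :: "nat \<Rightarrow> 'a::euclidean_space set \<Rightarrow> 'a set" where
  "dilate m P = (\<Sum>i<m. P)"

section \<open>The algebras and the toric ideal\<close>

text \<open>
  A monomial is its exponent function, so multiplication of monomials is \<open>+\<close> on
  \<^typ>\<open>'a \<Rightarrow>\<^sub>0 nat\<close>, and a polynomial maps monomials to coefficients.
\<close>

type_synonym 'a monomial = "'a \<Rightarrow>\<^sub>0 nat"
type_synonym 'a polynomial = "'a monomial \<Rightarrow>\<^sub>0 complex"

definition mdeg :: "'a monomial \<Rightarrow> nat" where
  "mdeg u = (\<Sum>x\<in>Poly_Mapping.keys u. Poly_Mapping.lookup u x)"

definition msum :: "'a::real_vector monomial \<Rightarrow> 'a" where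
  "msum u = (\<Sum>x\<in>Poly_Mapping.keys u. real (Poly_Mapping.lookup u x) *\<^sub>R x)"

definition monomials :: "'a::euclidean_space set \<Rightarrow> 'a monomial set" where
  "monomials P = {u. Poly_Mapping.keys u \<subseteq> lattice_points P}"

definition poly_algebra :: "'a::euclidean_space set \<Rightarrow> 'a polynomial ring" where
  "poly_algebra P = \<lparr>carrier = {p. Poly_Mapping.keys p \<subseteq> monomials P},
     mult = (*), one = 1, zero = 0, add = (+)\<rparr>"

text \<open>The basis element indexed by \<open>(m, b)\<close> is the lattice point \<open>b\<close> of \<open>mP\<close> in degree \<open>m\<close>.\<close>

definition polytope_algebra :: "'a::euclidean_space set \<Rightarrow> (nat \<times> 'a \<Rightarrow>\<^sub>0 complex) ring" where
  "polytope_algebra P =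
     \<lparr>carrier = {f. Poly_Mapping.keys f \<subseteq> (SIGMA m:UNIV. lattice_points (dilate m P))},
      mult = (*), one = 1, zero = 0, add = (+)\<rparr>"

definition toric_map :: "'a::euclidean_space polynomial \<Rightarrow> (nat \<times> 'a \<Rightarrow>\<^sub>0 complex)" where
  "toric_map p =
     (\<Sum>u\<in>Poly_Mapping.keys p. Poly_Mapping.single (mdeg u, msum u) (Poly_Mapping.lookup p u))"

definition toric_ideal :: "'a::euclidean_space set \<Rightarrow> 'a polynomial set" where
  "toric_ideal P = a_kernel (poly_algebra P) (polytope_algebra P) toric_map"

definition deg_le :: "nat \<Rightarrow> 'a polynomial \<Rightarrow> bool" where
  "deg_le k p \<longleftrightarrow> (\<forall>u\<in>Poly_Mapping.keys p. mdeg u \<le> k)"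

definition ideal_generated_deg_le :: "'a::euclidean_space set \<Rightarrow> 'a polynomial set \<Rightarrow> nat \<Rightarrow> bool" where
  "ideal_generated_deg_le P I k \<longleftrightarrow>
     (\<exists>G\<subseteq>I. (\<forall>g\<in>G. deg_le k g) \<and> I = Idl\<^bsub>poly_algebra P\<^esub> G)"

section \<open>Term orders and standard monomials\<close>

text \<open>A term order on \<open>P\<close> is a function \<open>\<sigma>\<close> of which only the values on \<open>lattice_points P\<close> matter.\<close>

definition weight :: "('a \<Rightarrow> real) \<Rightarrow> 'a monomial \<Rightarrow> real" where
  "weight \<sigma> u = (\<Sum>x\<in>Poly_Mapping.keys u. real (Poly_Mapping.lookup u x) * \<sigma> x)"

definition mon_less :: "('a \<Rightarrow> real) \<Rightarrow> 'a monomial \<Rightarrow> 'a monomial \<Rightarrow> bool" where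
  "mon_less \<sigma> u v \<longleftrightarrow> mdeg u < mdeg v \<or> mdeg u = mdeg v \<and> weight \<sigma> u < weight \<sigma> v"

definition initial_form :: "('a \<Rightarrow> real) \<Rightarrow> 'a polynomial \<Rightarrow> 'a polynomial" where
  "initial_form \<sigma> p =
     (\<Sum>u | u \<in> Poly_Mapping.keys p \<and> \<not> (\<exists>v\<in>Poly_Mapping.keys p. mon_less \<sigma> u v).
        Poly_Mapping.single u (Poly_Mapping.lookup p u))"

definition standard :: "'a::euclidean_space set \<Rightarrow> ('a \<Rightarrow> real) \<Rightarrow> 'a monomial \<Rightarrow> bool" where
  "standard P \<sigma> u \<longleftrightarrow>
     u \<in> monomials P \<and> \<not> (\<exists>p\<in>toric_ideal P. initial_form \<sigma> p = Poly_Mapping.single u 1)"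

definition monomial_fiber :: "'a::euclidean_space set \<Rightarrow> nat \<Rightarrow> 'a \<Rightarrow> 'a monomial set" where
  "monomial_fiber P m b = {u \<in> monomials P. mdeg u = m \<and> msum u = b}"

definition unique_standard_monomials :: "'a::euclidean_space set \<Rightarrow> ('a \<Rightarrow> real) \<Rightarrow> bool" where
  "unique_standard_monomials P \<sigma> \<longleftrightarrow>
     (\<forall>m. \<forall>b\<in>lattice_points (dilate m P). monomial_fiber P m b \<noteq> {} \<longrightarrow>
        (\<exists>!u. u \<in> monomial_fiber P m b \<and>
              (\<forall>v\<in>monomial_fiber P m b. weight \<sigma> u \<le> weight \<sigma> v)))"

definition flag :: "'a::euclidean_space set \<Rightarrow> ('a \<Rightarrow> real) \<Rightarrow> bool" where
  "flag P \<sigma> \<longleftrightarrow>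
     (\<forall>u\<in>monomials P.
        standard P \<sigma> u \<longleftrightarrow> (\<forall>d. mdeg d = 2 \<and> (\<exists>e. u = d + e) \<longrightarrow> standard P \<sigma> d)) \<and>
     (\<forall>x\<in>lattice_points P. \<forall>n. standard P \<sigma> (Poly_Mapping.single x n))"

section \<open>Standard regions and standard relations\<close>

definition standard_complex :: "'a::euclidean_space set \<Rightarrow> ('a \<Rightarrow> real) \<Rightarrow> 'a set set" where
  "standard_complex P \<sigma> =
     {S. S \<subseteq> lattice_points P \<and> (\<forall>u. Poly_Mapping.keys u = S \<longrightarrow> standard P \<sigma> u)}"

definition standard_regions :: "'a::euclidean_space set \<Rightarrow> ('a \<Rightarrow> real) \<Rightarrow> 'a set set" where
  "standard_regions P \<sigma> =
     {convex hull S | S. S \<in> standard_complex P \<sigma> \<and>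
        (\<forall>T\<in>standard_complex P \<sigma>. S \<subseteq> T \<longrightarrow> T = S)}"

definition standard_relations :: "'a::euclidean_space set \<Rightarrow> ('a \<Rightarrow> real) \<Rightarrow> 'a polynomial set" where
  "standard_relations P \<sigma> =
     {Poly_Mapping.single u 1 - Poly_Mapping.single v 1 | u v.
        Poly_Mapping.single u 1 - Poly_Mapping.single v 1 \<in> toric_ideal P \<and>
        (\<exists>R\<in>standard_regions P \<sigma>. u \<in> monomials R \<and> v \<in> monomials R)}"

definition standard_relations_generated_deg_le ::
  "'a::euclidean_space set \<Rightarrow> ('a \<Rightarrow> real) \<Rightarrow> nat \<Rightarrow> bool" where
  "standard_relations_generated_deg_le P \<sigma> k \<longleftrightarrow>
     standard_relations P \<sigma> \<subseteq> Idl\<^bsub>poly_algebra P\<^esub> {r \<in> standard_relations P \<sigma>. deg_le k r}"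

section \<open>Morphisms and fiber products\<close>

definition push_monomial :: "('a \<Rightarrow> 'b) \<Rightarrow> 'a monomial \<Rightarrow> 'b monomial" where
  "push_monomial \<pi> u =
     (\<Sum>x\<in>Poly_Mapping.keys u. Poly_Mapping.single (\<pi> x) (Poly_Mapping.lookup u x))"

text \<open>
  Objects are pairs of a lattice polytope and a term order. A morphism is represented by a linear map of
  the ambient spaces, of which only the restriction to the source polytope matters.
\<close>

definition is_object :: "'a::euclidean_space set \<times> ('a \<Rightarrow> real) \<Rightarrow> bool" where
  "is_object X \<longleftrightarrow> lattice_polytope (fst X)"

definition is_morphism ::
  "('a::euclidean_space \<Rightarrow> 'b::euclidean_space) \<Rightarrow>
   'a set \<times> ('a \<Rightarrow> real) \<Rightarrow> 'b set \<times> ('b \<Rightarrow> real) \<Rightarrow> bool" where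
  "is_morphism \<pi> X Y \<longleftrightarrow>
     is_object X \<and> is_object Y \<and>
     linear \<pi> \<and> \<pi> ` int_lattice \<subseteq> int_lattice \<and> \<pi> ` fst X \<subseteq> fst Y \<and>
     (\<forall>u. standard (fst X) (snd X) u \<longrightarrow> standard (fst Y) (snd Y) (push_monomial \<pi> u))"

definition fiber_product ::
  "('a \<Rightarrow> 'c) \<Rightarrow> 'a set \<times> ('a \<Rightarrow> real) \<Rightarrow> ('b \<Rightarrow> 'c) \<Rightarrow> 'b set \<times> ('b \<Rightarrow> real) \<Rightarrow>
   ('a \<times> 'b) set \<times> ('a \<times> 'b \<Rightarrow> real)" where
  "fiber_product \<pi>\<^sub>1 X\<^sub>1 \<pi>\<^sub>2 X\<^sub>2 =
     ({(x, y). x \<in> fst X\<^sub>1 \<and> y \<in> fst X\<^sub>2 \<and> \<pi>\<^sub>1 x = \<pi>\<^sub>2 y}, \<lambda>(u, v). snd X\<^sub>1 u + snd X\<^sub>2 v)"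

section \<open>Basic facts\<close>

lemma int_lattice_Times: "(int_lattice :: ('a::euclidean_space \<times> 'b::euclidean_space) set) = int_lattice \<times> int_lattice"
  by (auto simp: int_lattice_def Basis_prod_def ball_Un)

lemma int_lattice_add: "x \<in> int_lattice \<Longrightarrow> y \<in> int_lattice \<Longrightarrow> x + y \<in> int_lattice"
  by (auto simp: int_lattice_def inner_add_left)

lemma zero_in_int_lattice: "0 \<in> int_lattice"
  by (auto simp: int_lattice_def)

lemma dilate_0: "dilate 0 P = {0}"
  by (simp add: dilate_def)

lemma dilate_add: "dilate (m + n) P = dilate m P + dilate n P"
  by (induction m) (auto simp: dilate_def add_ac)

lemma monomials_add_iff: "u + v \<in> monomials P \<longleftrightarrow> u \<in> monomials P \<and> v \<in> monomials P"
  by (auto simp: monomials_def in_keys_iff lookup_add subset_iff)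

lemma mdeg_superset:
  assumes "finite A" "Poly_Mapping.keys u \<subseteq> A"
  shows "mdeg u = (\<Sum>x\<in>A. Poly_Mapping.lookup u x)"
  unfolding mdeg_def using assms by (intro sum.mono_neutral_left) (auto simp: in_keys_iff)

lemma msum_superset:
  assumes "finite A" "Poly_Mapping.keys u \<subseteq> A"
  shows "msum u = (\<Sum>x\<in>A. real (Poly_Mapping.lookup u x) *\<^sub>R x)"
  unfolding msum_def using assms by (intro sum.mono_neutral_left) (auto simp: in_keys_iff)

lemma mdeg_add: "mdeg (u + v) = mdeg u + mdeg v"
  using keys_add[of u v]
  by (simp add: mdeg_superset[of "Poly_Mapping.keys u \<union> Poly_Mapping.keys v"] lookup_add sum.distrib)

lemma msum_add: "msum (u + v) = msum u + msum v"
  using keys_add[of u v]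
  by (simp add: msum_superset[of "Poly_Mapping.keys u \<union> Poly_Mapping.keys v"] lookup_add
      sum.distrib scaleR_add_left)

lemma cring_poly_algebra: "cring (poly_algebra P)"
proof (rule cringI)
  show "abelian_group (poly_algebra P)"
  proof (rule abelian_groupI)
    fix x assume "x \<in> carrier (poly_algebra P)"
    then show "\<exists>y\<in>carrier (poly_algebra P). y \<oplus>\<^bsub>poly_algebra P\<^esub> x = \<zero>\<^bsub>poly_algebra P\<^esub>"
      by (intro bexI[of _ "-x"]) (auto simp: poly_algebra_def in_keys_iff subset_iff)
  qed (use keys_add in \<open>fastforce simp: poly_algebra_def add_ac\<close>)+
  show "Group.comm_monoid (poly_algebra P)"
  proof (rule comm_monoidI)
    fix p q assume "p \<in> carrier (poly_algebra P)" "q \<in> carrier (poly_algebra P)"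
    then show "p \<otimes>\<^bsub>poly_algebra P\<^esub> q \<in> carrier (poly_algebra P)"
      using keys_mult[of p q] by (fastforce simp: poly_algebra_def monomials_add_iff)
  qed (auto simp: poly_algebra_def mult_ac monomials_def)
qed (auto simp: poly_algebra_def algebra_simps)

lemma cring_polytope_algebra: "cring (polytope_algebra P)"
proof (rule cringI)
  show "abelian_group (polytope_algebra P)"
  proof (rule abelian_groupI)
    fix x assume "x \<in> carrier (polytope_algebra P)"
    then show "\<exists>y\<in>carrier (polytope_algebra P). y \<oplus>\<^bsub>polytope_algebra P\<^esub> x = \<zero>\<^bsub>polytope_algebra P\<^esub>"
      by (intro bexI[of _ "-x"]) (auto simp: polytope_algebra_def in_keys_iff subset_iff)
  qed (use keys_add in \<open>fastforce simp: polytope_algebra_def add_ac\<close>)+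
  show "Group.comm_monoid (polytope_algebra P)"
  proof (rule comm_monoidI)
    fix p q assume pq: "p \<in> carrier (polytope_algebra P)" "q \<in> carrier (polytope_algebra P)"
    have *: "(m + n, b + c) \<in> (SIGMA m:UNIV. lattice_points (dilate m P))"
      if "(m, b) \<in> Poly_Mapping.keys p" "(n, c) \<in> Poly_Mapping.keys q" for m n b c
    proof -
      have "b \<in> lattice_points (dilate m P)" "c \<in> lattice_points (dilate n P)"
        using that pq by (auto simp: polytope_algebra_def)
      then show ?thesis by (auto simp: lattice_points_def dilate_add int_lattice_add)
    qed
    show "p \<otimes>\<^bsub>polytope_algebra P\<^esub> q \<in> carrier (polytope_algebra P)"
      using keys_mult[of p q] * by (fastforce simp: polytope_algebra_def)
  next
    show "\<one>\<^bsub>polytope_algebra P\<^esub> \<in> carrier (polytope_algebra P)"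
      by (auto simp: polytope_algebra_def lattice_points_def zero_prod_def dilate_0 zero_in_int_lattice)
  qed (auto simp: polytope_algebra_def mult_ac)
qed (auto simp: polytope_algebra_def algebra_simps)

lemma toric_map_superset:
  assumes "finite A" "Poly_Mapping.keys p \<subseteq> A"
  shows "toric_map p =
    (\<Sum>u\<in>A. Poly_Mapping.single (mdeg u, msum u) (Poly_Mapping.lookup p u))"
  unfolding toric_map_def using assms by (intro sum.mono_neutral_left) (auto simp: in_keys_iff)

lemma toric_map_add: "toric_map (p + q) = toric_map p + toric_map q"
  using keys_add[of p q]
  by (simp add: toric_map_superset[of "Poly_Mapping.keys p \<union> Poly_Mapping.keys q"] lookup_add
      sum.distrib single_add)

lemma toric_map_single:
  "toric_map (Poly_Mapping.single u c) = Poly_Mapping.single (mdeg u, msum u) c"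
  by (simp add: toric_map_superset[of "{u}"])

lemma toric_map_var:
  "toric_map (Poly_Mapping.single (Poly_Mapping.single x 1) 1) = Poly_Mapping.single (1, x) 1"
  by (simp add: toric_map_single mdeg_def msum_def)

lemma toric_map_sum: "toric_map (sum f A) = (\<Sum>a\<in>A. toric_map (f a))"
  by (induction A rule: infinite_finite_induct) (auto simp: toric_map_add, simp_all add: toric_map_def)

lemma polynomial_expand:
  "p = (\<Sum>u\<in>Poly_Mapping.keys p. Poly_Mapping.single u (Poly_Mapping.lookup p u))"
  by (rule poly_mapping_eqI)
     (auto simp: lookup_sum lookup_single when_def in_keys_iff)

lemma toric_map_mult: "toric_map (p * q) = toric_map p * toric_map q"
proof -
  have "p * q = (\<Sum>u\<in>Poly_Mapping.keys p. \<Sum>v\<in>Poly_Mapping.keys q.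
      Poly_Mapping.single (u + v) (Poly_Mapping.lookup p u * Poly_Mapping.lookup q v))"
    by (subst (1) polynomial_expand[of p], subst (1) polynomial_expand[of q])
       (simp add: sum_product mult_single)
  then show ?thesis
    by (simp add: toric_map_sum toric_map_single mdeg_add msum_add)
       (simp add: toric_map_def sum_product mult_single)
qed

lemma msum_in_dilate: "u \<in> monomials P \<Longrightarrow> msum u \<in> lattice_points (dilate (mdeg u) P)"
proof (induction "mdeg u" arbitrary: u)
  case 0
  then have "u = 0" by (auto simp: mdeg_def in_keys_iff intro!: poly_mapping_eqI)
  then show ?case by (simp add: msum_def mdeg_def dilate_0 lattice_points_def zero_in_int_lattice)
next
  case (Suc n)
  then obtain x where x: "x \<in> Poly_Mapping.keys u" unfolding mdeg_def by fastforce
  define v where "v = u - Poly_Mapping.single x 1"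
  have u: "u = Poly_Mapping.single x 1 + v"
    using x by (intro poly_mapping_eqI)
       (auto simp: v_def lookup_add lookup_minus lookup_single when_def in_keys_iff)
  have 1: "mdeg (Poly_Mapping.single x (Suc 0)) = 1" "msum (Poly_Mapping.single x (Suc 0)) = x"
    by (simp_all add: mdeg_def msum_def)
  have "v \<in> monomials P" "mdeg v = n"
    using Suc.prems Suc.hyps(2) 1 by (auto simp: u monomials_add_iff mdeg_add)
  then have "msum v \<in> lattice_points (dilate n P)" using Suc.hyps(1) by blast
  moreover have "x \<in> lattice_points P" using Suc.prems x by (auto simp: monomials_def)
  moreover have "dilate (Suc n) P = P + dilate n P"
    using dilate_add[of 1 n P] by (simp add: dilate_def)
  ultimately show ?case
    using 1 \<open>mdeg v = n\<close> by (auto simp: u mdeg_add msum_add lattice_points_def int_lattice_add)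
qed

lemma toric_map_ring_hom: "toric_map \<in> ring_hom (poly_algebra P) (polytope_algebra P)"
proof (rule ring_hom_memI)
  fix p assume p: "p \<in> carrier (poly_algebra P)"
  have "Poly_Mapping.keys (toric_map p) \<subseteq> (\<lambda>u. (mdeg u, msum u)) ` Poly_Mapping.keys p"
    unfolding toric_map_def by (rule subset_trans[OF keys_sum]) auto
  then show "toric_map p \<in> carrier (polytope_algebra P)"
    using p msum_in_dilate[of _ P] by (fastforce simp: poly_algebra_def polytope_algebra_def)
next
  show "toric_map \<one>\<^bsub>poly_algebra P\<^esub> = \<one>\<^bsub>polytope_algebra P\<^esub>"
    using toric_map_single[of "0 :: 'a monomial" 1]
    by (simp add: poly_algebra_def polytope_algebra_def mdeg_def msum_def flip: zero_prod_def)
qed (auto simp: poly_algebra_def polytope_algebra_def toric_map_add toric_map_mult)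

lemma ideal_toric_ideal: "ideal (toric_ideal P) (poly_algebra P)"
  unfolding toric_ideal_def
  by (intro ring_hom_ring.kernel_is_ideal ring_hom_ringI2 cring.axioms(1)
      cring_poly_algebra cring_polytope_algebra toric_map_ring_hom)

end

theory Submission
  imports Defs "HOL-Analysis.Kronecker_Approximation_Theorem"
begin

text \<open>
  A lattice point of the fiber product \<open>F\<close> is a pair \<open>(x, y)\<close> of lattice points with \<open>\<pi>\<^sub>1 x = \<pi>\<^sub>2 y\<close>, so a
  monomial of \<open>F\<close> is a way of pairing up a monomial of \<open>P\<^sub>1\<close> and a monomial of \<open>P\<^sub>2\<close> that have the same image
  in \<open>Q\<close>. As toric ideals are spanned by differences of monomials of the same degree and sum, it suffices
  to connect any two such monomials of \<open>F\<close> by relations of degree at most \<open>K = max k\<^sub>1 k\<^sub>2\<close>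
  (\<open>toric_ideal_generated_if_linked\<close>). There are three kinds of moves.

  \<^item> Quadratic moves that make both projections standard (\<open>linked_to_standard\<close>). If a projection is not
    standard, then by flagness one of its quadratic divisors is not. It comes from two pairs in the monomial of
    \<open>F\<close>. Choose standard quadratic monomials of \<open>P\<^sub>1\<close> and \<open>P\<^sub>2\<close> with the same sums as the projections of these
    two pairs. Their images in \<open>Q\<close> are standard with the same sum, hence equal, so they can be paired up.
    The replacement decreases the weight, and there are finitely many monomials of each degree.
  \<^item> Standard relations of the factors (\<open>lift_standard_relations\<close>). Two standard monomials of \<open>P\<^sub>1\<close> with the
    same degree and sum lie in a common standard region (\<open>standard_pair_in_region\<close>), so they are connected
    by standard relations of degree at most \<open>k\<^sub>1\<close>. The two sides of such a relation are standard, by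
    uniqueness they have the same image in \<open>Q\<close>, and therefore the relation lifts to \<open>F\<close> with the second
    projection unchanged. Likewise for \<open>P\<^sub>2\<close>.
  \<^item> Quadratic swaps \<open>(x, y') (x', y) \<rightarrow> (x, y) (x', y')\<close>, which connect monomials of \<open>F\<close> with the same two
    projections (\<open>linked_same_projections\<close>).

  In the second kind of move, the two sides of a standard relation are known only to consist of lattice
  points of the convex hull of a face. That these points belong to the face, so that the two sides are standard,
  is \<open>lattice_points_standard_region\<close>.
\<close>

section \<open>Monomials as multisets of points\<close>

abbreviation point_monomial :: "'a \<Rightarrow> 'a monomial" where
  "point_monomial x \<equiv> Poly_Mapping.single x (Suc 0)"

lemma keys_add_nat: "Poly_Mapping.keys (u + v :: 'a monomial) = Poly_Mapping.keys u \<union> Poly_Mapping.keys v"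
  by (auto simp: in_keys_iff lookup_add)

lemma mdeg_0 [simp]: "mdeg 0 = 0"
  by (simp add: mdeg_def)

lemma mdeg_single [simp]: "mdeg (Poly_Mapping.single x n) = n"
  by (simp add: mdeg_def)

lemma msum_0 [simp]: "msum 0 = 0"
  by (simp add: msum_def)

lemma msum_single [simp]: "msum (Poly_Mapping.single x n) = real n *\<^sub>R x"
  by (simp add: msum_def)

lemma split_off_point:
  assumes "x \<in> Poly_Mapping.keys u"
  obtains v where "u = point_monomial x + v"
proof
  show "u = point_monomial x + (u - point_monomial x)"
    using assms by (intro poly_mapping_eqI)
      (auto simp: lookup_add lookup_minus lookup_single when_def in_keys_iff)
qed

lemma monomial_induct [case_names zero add]:
  assumes "P 0" and "\<And>x u. P u \<Longrightarrow> P (point_monomial x + u)"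
  shows "P u"
proof (induction "mdeg u" arbitrary: u)
  case 0
  then have "u = 0" by (auto simp: mdeg_def in_keys_iff intro!: poly_mapping_eqI)
  then show ?case using assms(1) by simp
next
  case (Suc n)
  then have "u \<noteq> 0" by auto
  then obtain x v where "u = point_monomial x + v"
    by (metis split_off_point keys_eq_empty ex_in_conv)
  then show ?case using Suc assms(2) by (auto simp: mdeg_add)
qed

lemma mdeg_eq_0_iff [simp]: "mdeg u = 0 \<longleftrightarrow> u = 0"
proof
  assume "mdeg u = 0"
  then show "u = 0" by (auto simp: mdeg_def in_keys_iff intro!: poly_mapping_eqI)
qed simp

lemma mdeg_2_cases:
  assumes "mdeg u = 2"
  obtains x y where "u = point_monomial x + point_monomial y"
proof -
  from assms have "u \<noteq> 0" by auto
  then obtain x v where u: "u = point_monomial x + v"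
    by (metis split_off_point keys_eq_empty ex_in_conv)
  with assms have v: "mdeg v = 1" by (simp add: mdeg_add)
  then have "v \<noteq> 0" by auto
  then obtain y v' where v': "v = point_monomial y + v'"
    by (metis split_off_point keys_eq_empty ex_in_conv)
  with v have "v' = 0" by (simp add: mdeg_add)
  with u v' show thesis using that by simp
qed

lemma weight_superset:
  assumes "finite A" "Poly_Mapping.keys u \<subseteq> A"
  shows "weight \<sigma> u = (\<Sum>x\<in>A. real (Poly_Mapping.lookup u x) * \<sigma> x)"
  unfolding weight_def using assms by (intro sum.mono_neutral_left) (auto simp: in_keys_iff)

lemma weight_add: "weight \<sigma> (u + v) = weight \<sigma> u + weight \<sigma> v"
  by (simp add: weight_superset[of "Poly_Mapping.keys u \<union> Poly_Mapping.keys v"] lookup_add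
      sum.distrib distrib_right keys_add_nat)

lemma weight_0 [simp]: "weight \<sigma> 0 = 0"
  by (simp add: weight_def)

lemma weight_single [simp]: "weight \<sigma> (Poly_Mapping.single x n) = real n * \<sigma> x"
  by (simp add: weight_def)

lemma finite_monomials_of_degree:
  assumes "finite A"
  shows "finite {u :: 'a monomial. Poly_Mapping.keys u \<subseteq> A \<and> mdeg u = m}"
proof (induction m)
  case 0
  have "{u :: 'a monomial. Poly_Mapping.keys u \<subseteq> A \<and> mdeg u = 0} \<subseteq> {0}" by auto
  then show ?case by (rule finite_subset) simp
next
  case (Suc m)
  have "{u :: 'a monomial. Poly_Mapping.keys u \<subseteq> A \<and> mdeg u = Suc m} \<subseteq>
    (\<Union>x\<in>A. (+) (point_monomial x) ` {u. Poly_Mapping.keys u \<subseteq> A \<and> mdeg u = m})"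
  proof
    fix u :: "'a monomial" assume "u \<in> {u. Poly_Mapping.keys u \<subseteq> A \<and> mdeg u = Suc m}"
    then have u: "Poly_Mapping.keys u \<subseteq> A" "mdeg u = Suc m" by auto
    then obtain x where x: "x \<in> Poly_Mapping.keys u"
      by (metis mdeg_0 keys_eq_empty ex_in_conv nat.distinct(1))
    then obtain v where "u = point_monomial x + v" by (rule split_off_point)
    then show "u \<in> (\<Union>x\<in>A. (+) (point_monomial x) ` {u. Poly_Mapping.keys u \<subseteq> A \<and> mdeg u = m})"
      using u x by (auto simp: keys_add_nat mdeg_add)
  qed
  then show ?case by (rule finite_subset) (use assms Suc in auto)
qed

lemma push_monomial_superset:
  assumes "finite A" "Poly_Mapping.keys u \<subseteq> A"
  shows "push_monomial f u = (\<Sum>x\<in>A. Poly_Mapping.single (f x) (Poly_Mapping.lookup u x))"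
  unfolding push_monomial_def using assms by (intro sum.mono_neutral_left) (auto simp: in_keys_iff)

lemma push_monomial_add: "push_monomial f (u + v) = push_monomial f u + push_monomial f v"
  by (simp add: push_monomial_superset[of "Poly_Mapping.keys u \<union> Poly_Mapping.keys v"] lookup_add
      sum.distrib single_add keys_add_nat)

lemma push_monomial_0 [simp]: "push_monomial f 0 = 0"
  by (simp add: push_monomial_def)

lemma push_monomial_single [simp]:
  "push_monomial f (Poly_Mapping.single x n) = Poly_Mapping.single (f x) n"
  by (simp add: push_monomial_def)

lemma mdeg_push_monomial [simp]: "mdeg (push_monomial f u) = mdeg u"
  by (induction u rule: monomial_induct) (auto simp: push_monomial_add mdeg_add)

lemma msum_push_monomial: "linear f \<Longrightarrow> msum (push_monomial f u) = f (msum u)"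
  by (induction u rule: monomial_induct)
    (auto simp: push_monomial_add msum_add linear_add linear_0)

lemma keys_push_monomial: "Poly_Mapping.keys (push_monomial f u) = f ` Poly_Mapping.keys u"
  by (induction u rule: monomial_induct) (auto simp: push_monomial_add keys_add_nat)

lemma push_monomial_comp: "push_monomial f (push_monomial g u) = push_monomial (f \<circ> g) u"
  by (induction u rule: monomial_induct) (auto simp: push_monomial_add)

lemma push_monomial_cong:
  assumes "\<And>x. x \<in> Poly_Mapping.keys u \<Longrightarrow> f x = g x"
  shows "push_monomial f u = push_monomial g u"
  using assms by (induction u rule: monomial_induct) (auto simp: push_monomial_add keys_add_nat)

text \<open>
  A divisor of the image monomial lifts to a divisor of the monomial: a preimage of each point of
  \<open>a\<close> can be picked, one point after the other. This is how a relation among the projections of a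
  monomial is localized to a divisor of that monomial.
\<close>

lemma push_monomial_split:
  assumes "push_monomial f w = a + c"
  obtains v r where "w = v + r" "push_monomial f v = a" "push_monomial f r = c"
  using assms
proof (induction a arbitrary: w c thesis rule: monomial_induct)
  case zero
  show ?case by (rule zero(1)[of 0 w]) (use zero(2) in auto)
next
  case (add x a)
  have "x \<in> f ` Poly_Mapping.keys w"
    using arg_cong[OF add.prems(2), of Poly_Mapping.keys]
    by (auto simp: keys_push_monomial keys_add_nat)
  then obtain z where z: "z \<in> Poly_Mapping.keys w" "f z = x" by auto
  from z(1) obtain w' where w': "w = point_monomial z + w'" by (rule split_off_point)
  have "push_monomial f w' = a + c"
    using add.prems(2) z(2) by (simp add: w' push_monomial_add add.assoc)
  then obtain v r where "w' = v + r" "push_monomial f v = a" "push_monomial f r = c"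
    using add.IH by blast
  then show ?case
    by (intro add.prems(1)[of "point_monomial z + v" r]) (auto simp: w' z push_monomial_add add.assoc)
qed

section \<open>Standard monomials\<close>

lemma toric_ideal_iff:
  "p \<in> toric_ideal P \<longleftrightarrow> Poly_Mapping.keys p \<subseteq> monomials P \<and> toric_map p = 0"
  by (simp add: toric_ideal_def a_kernel_def' poly_algebra_def polytope_algebra_def)

abbreviation monomial_diff :: "'a monomial \<Rightarrow> 'a monomial \<Rightarrow> 'a polynomial" where
  "monomial_diff u v \<equiv> Poly_Mapping.single u 1 - Poly_Mapping.single v 1"

lemma keys_monomial_diff:
  "Poly_Mapping.keys (monomial_diff u v) = (if u = v then {} else {u, v})"
  by (auto simp: in_keys_iff lookup_minus lookup_single when_def split: if_splits)

lemma toric_map_monomial_diff: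
  "toric_map (monomial_diff u v) =
    Poly_Mapping.single (mdeg u, msum u) 1 - Poly_Mapping.single (mdeg v, msum v) 1"
proof -
  have "toric_map (monomial_diff u v) + toric_map (Poly_Mapping.single v 1) = toric_map (Poly_Mapping.single u 1)"
    by (simp flip: toric_map_add)
  then show ?thesis by (simp add: toric_map_single eq_diff_eq)
qed

lemma monomial_diff_in_toric_ideal_iff:
  assumes "u \<in> monomials P" "v \<in> monomials P"
  shows "monomial_diff u v \<in> toric_ideal P \<longleftrightarrow> mdeg u = mdeg v \<and> msum u = msum v"
proof -
  have "Poly_Mapping.single (mdeg u, msum u) (1::complex) - Poly_Mapping.single (mdeg v, msum v) 1 = 0 \<longleftrightarrow>
      (mdeg u, msum u) = (mdeg v, msum v)"
    by (metis (mono_tags, lifting) diff_self lookup_single_eq lookup_single_not_eq right_minus_eq zero_neq_one)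
  then show ?thesis
    using assms by (auto simp: toric_ideal_iff toric_map_monomial_diff keys_monomial_diff)
qed

lemma lookup_toric_map:
  "Poly_Mapping.lookup (toric_map p) (m, b) =
    (\<Sum>u\<in>{u \<in> Poly_Mapping.keys p. mdeg u = m \<and> msum u = b}. Poly_Mapping.lookup p u)"
  unfolding toric_map_def lookup_sum
  by (intro sum.mono_neutral_cong_right) (auto simp: lookup_single when_def)

text \<open>
  The coefficients of an element of the toric ideal add up to \<open>0\<close> over each fiber of monomials of
  equal degree and sum, so no monomial of the element is alone in its fiber.
\<close>

lemma toric_ideal_same_image:
  assumes "p \<in> toric_ideal P" "u \<in> Poly_Mapping.keys p"
  obtains v where "v \<in> Poly_Mapping.keys p" "v \<noteq> u" "mdeg v = mdeg u" "msum v = msum u"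
proof (rule ccontr)
  assume "\<not> thesis"
  with that assms(2) have "{v \<in> Poly_Mapping.keys p. mdeg v = mdeg u \<and> msum v = msum u} = {u}" by auto
  then have "Poly_Mapping.lookup (toric_map p) (mdeg u, msum u) = Poly_Mapping.lookup p u"
    by (simp add: lookup_toric_map)
  with assms show False by (simp add: toric_ideal_iff in_keys_iff)
qed

lemma keys_initial_form:
  "Poly_Mapping.keys (initial_form \<sigma> p) =
    {u \<in> Poly_Mapping.keys p. \<not> (\<exists>v\<in>Poly_Mapping.keys p. mon_less \<sigma> u v)}"
  by (auto simp: initial_form_def in_keys_iff lookup_sum lookup_single when_def split: if_splits)

text \<open>
  Standardness becomes a minimization over a fiber, which is the only form in which it is used below.
  A monomial of greater weight than another one in its fiber is the initial form of their difference.
  Conversely, if \<open>u\<close> is the initial form of \<open>p\<close>, then the second monomial of \<open>p\<close> in the fiber of \<open>u\<close> must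
  have smaller weight.
\<close>

lemma standard_iff:
  "standard P \<sigma> u \<longleftrightarrow> u \<in> monomials P \<and>
    (\<forall>v\<in>monomials P. mdeg v = mdeg u \<longrightarrow> msum v = msum u \<longrightarrow> weight \<sigma> u \<le> weight \<sigma> v)"
proof (intro iffI conjI ballI impI)
  assume std: "standard P \<sigma> u"
  then show u: "u \<in> monomials P" by (simp add: standard_def)
  fix v assume v: "v \<in> monomials P" "mdeg v = mdeg u" "msum v = msum u"
  show "weight \<sigma> u \<le> weight \<sigma> v"
  proof (rule ccontr)
    assume less: "\<not> weight \<sigma> u \<le> weight \<sigma> v"
    then have "u \<noteq> v" by auto
    with less v have "{w \<in> Poly_Mapping.keys (monomial_diff u v).
        \<not> (\<exists>t\<in>Poly_Mapping.keys (monomial_diff u v). mon_less \<sigma> w t)} = {u}"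
      by (auto simp: keys_monomial_diff mon_less_def)
    then have "initial_form \<sigma> (monomial_diff u v) = Poly_Mapping.single u 1"
      using \<open>u \<noteq> v\<close> by (simp add: initial_form_def lookup_minus lookup_single)
    moreover have "monomial_diff u v \<in> toric_ideal P"
      using u v by (simp add: monomial_diff_in_toric_ideal_iff)
    ultimately show False using std by (auto simp: standard_def)
  qed
next
  assume u: "u \<in> monomials P \<and>
    (\<forall>v\<in>monomials P. mdeg v = mdeg u \<longrightarrow> msum v = msum u \<longrightarrow> weight \<sigma> u \<le> weight \<sigma> v)"
  show "standard P \<sigma> u"
  proof (rule ccontr)
    assume "\<not> standard P \<sigma> u"
    with u obtain p where p: "p \<in> toric_ideal P" "initial_form \<sigma> p = Poly_Mapping.single u 1"
      by (auto simp: standard_def)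
    let ?K = "Poly_Mapping.keys p"
    have max: "{u \<in> ?K. \<not> (\<exists>v\<in>?K. mon_less \<sigma> u v)} = {u}"
      using keys_initial_form[of \<sigma> p] p(2) by simp
    then have "u \<in> ?K" by auto
    with p(1) obtain v where v: "v \<in> ?K" "v \<noteq> u" "mdeg v = mdeg u" "msum v = msum u"
      by (rule toric_ideal_same_image)
    \<comment> \<open>\<open>v\<close> is not maximal among the monomials of \<open>p\<close>, so it lies below the only maximal one.\<close>
    have "{t \<in> ?K. mon_less \<sigma> v t} \<noteq> {}" using max v(1,2) by auto
    moreover have "transp_on A (mon_less \<sigma>)" "asymp_on A (mon_less \<sigma>)" for A
      by (auto simp: transp_on_def asymp_on_def mon_less_def)
    ultimately obtain t where t: "t \<in> ?K" "mon_less \<sigma> v t"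
      "\<And>s. s \<in> ?K \<Longrightarrow> mon_less \<sigma> v s \<Longrightarrow> s \<noteq> t \<Longrightarrow> \<not> mon_less \<sigma> t s"
      using Finite_Set.bex_max_element[of "{t \<in> ?K. mon_less \<sigma> v t}" "mon_less \<sigma>"] by auto
    have "\<not> mon_less \<sigma> t s" if "s \<in> ?K" for s
    proof
      assume "mon_less \<sigma> t s"
      with t(2) have "mon_less \<sigma> v s" "s \<noteq> t" by (auto simp: mon_less_def)
      with t(3) that \<open>mon_less \<sigma> t s\<close> show False by blast
    qed
    with t(1) max have "t = u" by auto
    with t(2) v(3) have "weight \<sigma> v < weight \<sigma> u" by (auto simp: mon_less_def)
    moreover have "v \<in> monomials P" using p(1) v(1) by (auto simp: toric_ideal_iff)
    ultimately show False using u v by force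
  qed
qed

lemma standard_in_monomials: "standard P \<sigma> u \<Longrightarrow> u \<in> monomials P"
  by (simp add: standard_iff)

lemma standard_weight_le:
  "standard P \<sigma> u \<Longrightarrow> v \<in> monomials P \<Longrightarrow> mdeg v = mdeg u \<Longrightarrow> msum v = msum u \<Longrightarrow> weight \<sigma> u \<le> weight \<sigma> v"
  by (simp add: standard_iff)

lemma standard_weight_eq:
  assumes "standard P \<sigma> u" "standard P \<sigma> v" "mdeg u = mdeg v" "msum u = msum v"
  shows "weight \<sigma> u = weight \<sigma> v"
  using assms by (intro antisym standard_weight_le standard_in_monomials) auto

lemma standard_if_weight_le:
  assumes "standard P \<sigma> u" "v \<in> monomials P" "mdeg v = mdeg u" "msum v = msum u" "weight \<sigma> v \<le> weight \<sigma> u"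
  shows "standard P \<sigma> v"
  using assms by (fastforce simp: standard_iff)

text \<open>
  A divisor could otherwise be replaced by a lighter monomial of its fiber inside the product.
\<close>

lemma standard_addD:
  assumes "standard P \<sigma> (u + v)"
  shows "standard P \<sigma> u"
proof -
  have "weight \<sigma> u \<le> weight \<sigma> w"
    if "w \<in> monomials P" "mdeg w = mdeg u" "msum w = msum u" for w
    using standard_weight_le[OF assms, of "w + v"] that standard_in_monomials[OF assms]
    by (simp add: monomials_add_iff mdeg_add msum_add weight_add)
  then show ?thesis using standard_in_monomials[OF assms] by (auto simp: standard_iff monomials_add_iff)
qed

lemma ex_standard:
  assumes "finite (lattice_points P)" "u \<in> monomials P"
  obtains v where "standard P \<sigma> v" "mdeg v = mdeg u" "msum v = msum u"
proof -
  let ?D = "{v \<in> monomials P. mdeg v = mdeg u \<and> msum v = msum u}"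
  have "?D \<subseteq> {v. Poly_Mapping.keys v \<subseteq> lattice_points P \<and> mdeg v = mdeg u}"
    by (auto simp: monomials_def)
  then have fin: "finite ?D" by (rule finite_subset) (intro finite_monomials_of_degree assms)
  have "u \<in> ?D" using assms(2) by simp
  with fin obtain v where "v \<in> ?D" "\<And>w. w \<in> ?D \<Longrightarrow> weight \<sigma> v \<le> weight \<sigma> w"
    using ex_min_if_finite[of "weight \<sigma> ` ?D"] by (fastforce simp: not_less)
  then show thesis using that[of v] by (auto simp: standard_iff)
qed

lemma unique_standardD:
  assumes "unique_standard_monomials Q \<sigma>" "standard Q \<sigma> u" "standard Q \<sigma> v"
    and "mdeg u = mdeg v" "msum u = msum v"
  shows "u = v"
proof -
  have u: "u \<in> monomial_fiber Q (mdeg u) (msum u)" and v: "v \<in> monomial_fiber Q (mdeg u) (msum u)"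
    using assms by (auto simp: monomial_fiber_def standard_in_monomials)
  have "msum u \<in> lattice_points (dilate (mdeg u) Q)"
    by (rule msum_in_dilate) (rule standard_in_monomials[OF assms(2)])
  with u assms(1) have "\<exists>!w. w \<in> monomial_fiber Q (mdeg u) (msum u) \<and>
      (\<forall>t\<in>monomial_fiber Q (mdeg u) (msum u). weight \<sigma> w \<le> weight \<sigma> t)"
    unfolding unique_standard_monomials_def by blast
  moreover have "\<forall>t\<in>monomial_fiber Q (mdeg u) (msum u). weight \<sigma> u \<le> weight \<sigma> t"
    "\<forall>t\<in>monomial_fiber Q (mdeg u) (msum u). weight \<sigma> v \<le> weight \<sigma> t"
    using assms by (auto simp: monomial_fiber_def standard_iff)
  ultimately show ?thesis using u v by blast
qed

section \<open>Lattice points of polytopes\<close>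

lemma finite_lattice_points_bounded:
  fixes P :: "'a::euclidean_space set"
  assumes "bounded P"
  shows "finite (lattice_points P)"
proof -
  obtain B where B: "\<And>x. x \<in> P \<Longrightarrow> norm x \<le> B" using assms by (auto simp: bounded_iff)
  define coords where "coords = (\<lambda>x::'a. restrict (\<lambda>b. x \<bullet> b) Basis)"
  define Z where "Z = {z::real. z \<in> \<int> \<and> \<bar>z\<bar> \<le> B}"
  have inj: "inj_on coords (lattice_points P)"
  proof (rule inj_onI)
    fix x y assume "coords x = coords y"
    then have "x \<bullet> b = y \<bullet> b" if "b \<in> Basis" for b
      using that by (auto simp: coords_def dest: fun_cong[of _ _ b])
    then show "x = y" by (rule euclidean_eqI)
  qed
  \<comment> \<open>The points are encoded by their coordinates, which are integers of bounded absolute value.\<close>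
  have "coords ` lattice_points P \<subseteq> Basis \<rightarrow>\<^sub>E Z"
  proof (clarsimp simp: coords_def Z_def lattice_points_def int_lattice_def)
    fix x b :: 'a assume "x \<in> P" "b \<in> Basis"
    then show "\<bar>x \<bullet> b\<bar> \<le> B" using B[of x] Basis_le_norm[of b x] by linarith
  qed
  moreover have "finite (Basis \<rightarrow>\<^sub>E Z)"
    unfolding Z_def by (intro finite_PiE finite_Basis finite_abs_int_segment)
  ultimately show ?thesis using inj finite_subset finite_imageD by metis
qed

lemma finite_lattice_points:
  assumes "lattice_polytope P"
  shows "finite (lattice_points P)"
proof (rule finite_lattice_points_bounded)
  obtain V where "finite V" "P = convex hull V"
    using assms unfolding lattice_polytope_def by auto
  then show "bounded P" by (simp add: bounded_convex_hull finite_imp_bounded)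
qed

text \<open>
  A lattice point is a priori a \<^emph>\<open>real\<close> convex combination of lattice points; some positive multiple of it
  is a sum of these points with multiplicities. Dirichlet's simultaneous approximation supplies a \<open>q\<close> such
  that all coefficients multiplied by \<open>q\<close> are so close to integers that replacing them by these integers
  changes the combination by a lattice vector of coordinates smaller than \<open>1\<close>, that is, not at all.
\<close>

lemma lattice_point_of_convex_hull_multiple:
  fixes S :: "'a::euclidean_space set"
  assumes S: "finite S" "S \<subseteq> int_lattice" and x: "x \<in> convex hull S" "x \<in> int_lattice"
  obtains n where "Poly_Mapping.keys n \<subseteq> S" "mdeg n > 0" "msum n = real (mdeg n) *\<^sub>R x"
proof -
  obtain l where l: "\<And>s. s \<in> S \<Longrightarrow> 0 \<le> l s" "sum l S = 1" "(\<Sum>s\<in>S. l s *\<^sub>R s) = x"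
    using x(1) by (auto simp: convex_hull_finite[OF S(1)])
  obtain e where e: "bij_betw e S {..<card S}"
    using S(1) by (metis ex_bij_betw_finite_nat lessThan_atLeast0)
  \<comment> \<open>\<open>M\<close> bounds the error amplification in each coordinate; the summand \<open>1\<close> serves the
  sum of the coefficients in the same way.\<close>
  define M where "M = (\<Sum>s\<in>S. 1 + (\<Sum>b\<in>Basis. \<bar>s \<bullet> b\<bar>))"
  have M: "0 \<le> M" unfolding M_def by (intro sum_nonneg add_nonneg_nonneg) auto
  define N where "N = Suc (nat \<lceil>M\<rceil>)"
  have N: "M < real N" unfolding N_def by linarith
  have "0 < N" by (simp add: N_def)
  obtain q p where q: "0 < q" and "q \<le> int (N ^ card S)"
    and p: "\<And>i. i < card S \<Longrightarrow> \<bar>of_int q * l (inv_into S e i) - of_int (p i)\<bar> < 1 / real N"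
    by (rule Dirichlet_approx_simult[OF \<open>0 < N\<close>, where \<theta> = "\<lambda>i. l (inv_into S e i)" and n = "card S"]) blast
  define t where "t s = p (e s)" for s
  have approx: "\<bar>of_int q * l s - of_int (t s)\<bar> < 1 / real N" if "s \<in> S" for s
  proof -
    have "e s < card S" "inv_into S e (e s) = s"
      using e that by (auto simp: bij_betw_def)
    then show ?thesis using p[of "e s"] by (simp add: t_def)
  qed
  have t_nonneg: "0 \<le> t s" if "s \<in> S" for s
  proof -
    have "0 \<le> of_int q * l s" using q l(1)[OF that] by simp
    moreover have "\<bar>of_int q * l s - of_int (t s)\<bar> < 1"
      by (rule less_le_trans[OF approx[OF that]]) (simp add: N_def)
    ultimately have "- 1 < real_of_int (t s)" by linarith
    then show ?thesis by linarith
  qed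
  \<comment> \<open>Integral combinations of the errors have absolute value below \<open>1\<close> and are integral, so they vanish.\<close>
  have vanish: "(\<Sum>s\<in>S. (of_int q * l s - of_int (t s)) * c s) = 0"
    if c: "(\<Sum>s\<in>S. (of_int q * l s - of_int (t s)) * c s) \<in> \<int>"
      "\<And>s. s \<in> S \<Longrightarrow> \<bar>c s\<bar> \<le> 1 + (\<Sum>b\<in>Basis. \<bar>s \<bullet> b\<bar>)" for c :: "'a \<Rightarrow> real"
  proof (rule Ints_nonzero_abs_less1[OF c(1)])
    have "\<bar>(of_int q * l s - of_int (t s)) * c s\<bar> \<le> 1 / real N * (1 + (\<Sum>b\<in>Basis. \<bar>s \<bullet> b\<bar>))"
      if "s \<in> S" for s
      unfolding abs_mult by (intro mult_mono less_imp_le[OF approx] c(2) that) auto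
    then have "\<bar>\<Sum>s\<in>S. (of_int q * l s - of_int (t s)) * c s\<bar> \<le>
        (\<Sum>s\<in>S. 1 / real N * (1 + (\<Sum>b\<in>Basis. \<bar>s \<bullet> b\<bar>)))"
      by (rule sum_abs[THEN order_trans, OF sum_mono])
    also have "\<dots> = M / real N" by (simp add: M_def sum_divide_distrib)
    also have "\<dots> < 1" using N M by simp
    finally show "\<bar>\<Sum>s\<in>S. (of_int q * l s - of_int (t s)) * c s\<bar> < 1" .
  qed
  have sum_t: "(\<Sum>s\<in>S. of_int (t s)) = (of_int q :: real)"
  proof -
    have *: "(\<Sum>s\<in>S. (of_int q * l s - of_int (t s)) * 1) = of_int (q - sum t S)"
      using l(2) by (simp add: sum_subtractf flip: sum_distrib_left)
    have "(\<Sum>s\<in>S. (of_int q * l s - of_int (t s)) * 1) = 0"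
      by (rule vanish) (unfold *, auto intro: sum_nonneg)
    then show ?thesis unfolding * by simp
  qed
  have comb_t: "(\<Sum>s\<in>S. of_int (t s) *\<^sub>R s) = of_int q *\<^sub>R x"
  proof (rule euclidean_eqI)
    fix b :: 'a assume b: "b \<in> Basis"
    have *: "(\<Sum>s\<in>S. (of_int q * l s - of_int (t s)) * (s \<bullet> b)) =
        of_int q * (x \<bullet> b) - (\<Sum>s\<in>S. of_int (t s) * (s \<bullet> b))"
      by (simp add: l(3)[symmetric] inner_sum_left sum_distrib_left sum_subtractf left_diff_distrib mult.assoc)
    have "x \<bullet> b \<in> \<int>" "\<And>s. s \<in> S \<Longrightarrow> s \<bullet> b \<in> \<int>" using x(2) S(2) b by (auto simp: int_lattice_def)
    then have "(\<Sum>s\<in>S. (of_int q * l s - of_int (t s)) * (s \<bullet> b)) \<in> \<int>"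
      unfolding * by (intro Ints_diff Ints_mult Ints_sum Ints_of_int)
    moreover have "\<bar>s \<bullet> b\<bar> \<le> 1 + (\<Sum>b\<in>Basis. \<bar>s \<bullet> b\<bar>)" for s
      using member_le_sum[of b Basis "\<lambda>b. \<bar>s \<bullet> b\<bar>"] b by force
    ultimately have "(\<Sum>s\<in>S. (of_int q * l s - of_int (t s)) * (s \<bullet> b)) = 0"
      by (rule vanish)
    then show "(\<Sum>s\<in>S. of_int (t s) *\<^sub>R s) \<bullet> b = (of_int q *\<^sub>R x) \<bullet> b"
      unfolding * by (simp add: inner_sum_left)
  qed
  define n where "n = (\<Sum>s\<in>S. Poly_Mapping.single s (nat (t s)))"
  have lookup_n: "Poly_Mapping.lookup n s = (if s \<in> S then nat (t s) else 0)" for s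
    using S(1) by (simp add: n_def lookup_sum lookup_single when_def)
  then have keys: "Poly_Mapping.keys n \<subseteq> S" by (auto simp: in_keys_iff split: if_splits)
  have "real (mdeg n) = (\<Sum>s\<in>S. of_int (t s))"
    unfolding mdeg_superset[OF S(1) keys] using t_nonneg by (auto simp: lookup_n intro!: sum.cong)
  then have deg: "real (mdeg n) = of_int q" by (simp add: sum_t)
  have "msum n = (\<Sum>s\<in>S. of_int (t s) *\<^sub>R s)"
    unfolding msum_superset[OF S(1) keys] using t_nonneg by (auto simp: lookup_n intro!: sum.cong)
  then have "msum n = real (mdeg n) *\<^sub>R x" by (simp add: comb_t deg)
  moreover have "mdeg n > 0" using deg q by (metis of_int_0_less_iff of_nat_0_less_iff)
  ultimately show thesis using that keys by blast
qed

section \<open>Standard regions of a flag term order\<close>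

text \<open>
  A degree \<open>2\<close> divisor \<open>x y\<close> of \<open>v\<close> with \<open>x \<noteq> y\<close> divides \<open>u\<close>, whatever the exponents are, and squares are
  standard because pure powers are. So for a flag term order standardness depends only on the support.
\<close>

lemma flag_standard_keys_subset:
  assumes flag: "flag P \<sigma>" and u: "standard P \<sigma> u" and keys: "Poly_Mapping.keys v \<subseteq> Poly_Mapping.keys u"
  shows "standard P \<sigma> v"
proof -
  have v: "v \<in> monomials P" using standard_in_monomials[OF u] keys by (auto simp: monomials_def)
  have "standard P \<sigma> d" if d: "mdeg d = 2" "v = d + e" for d e
  proof -
    obtain x y where xy: "d = point_monomial x + point_monomial y"
      using d(1) by (rule mdeg_2_cases)
    with d(2) keys have x: "x \<in> Poly_Mapping.keys u" and y: "y \<in> Poly_Mapping.keys u"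
      by (auto simp: keys_add_nat)
    show ?thesis
    proof (cases "x = y")
      case True
      then have "d = Poly_Mapping.single x 2"
        by (simp add: xy numeral_2_eq_2 flip: single_add)
      then show ?thesis
        using flag x standard_in_monomials[OF u] by (auto simp: flag_def monomials_def)
    next
      case False
      obtain r where r: "u = point_monomial x + r" using x by (rule split_off_point)
      with y False have "y \<in> Poly_Mapping.keys r" by (auto simp: keys_add_nat)
      then obtain r' where "r = point_monomial y + r'" by (rule split_off_point)
      with r u have "standard P \<sigma> (d + r')" by (simp add: xy add.assoc)
      then show ?thesis by (rule standard_addD)
    qed
  qed
  then show ?thesis using flag v unfolding flag_def by blast
qed

lemma flag_standard_complex_iff:
  assumes "flag P \<sigma>" "finite (lattice_points P)"
  shows "S \<in> standard_complex P \<sigma> \<longleftrightarrow>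
    S \<subseteq> lattice_points P \<and> (\<forall>u. Poly_Mapping.keys u \<subseteq> S \<longrightarrow> standard P \<sigma> u)"
proof
  assume S: "S \<in> standard_complex P \<sigma>"
  then have "finite S" using assms(2) by (auto simp: standard_complex_def intro: finite_subset)
  define w where "w = (\<Sum>s\<in>S. point_monomial s)"
  have "Poly_Mapping.keys w = S"
    using \<open>finite S\<close> by (auto simp: w_def in_keys_iff lookup_sum lookup_single when_def split: if_splits)
  with S have "standard P \<sigma> w" by (auto simp: standard_complex_def)
  with S show "S \<subseteq> lattice_points P \<and> (\<forall>u. Poly_Mapping.keys u \<subseteq> S \<longrightarrow> standard P \<sigma> u)"
    using flag_standard_keys_subset[OF assms(1)] \<open>Poly_Mapping.keys w = S\<close>
    by (auto simp: standard_complex_def)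
qed (auto simp: standard_complex_def)

lemma flag_keys_in_standard_complex:
  assumes "flag P \<sigma>" "standard P \<sigma> u"
  shows "Poly_Mapping.keys u \<in> standard_complex P \<sigma>"
  using assms standard_in_monomials[OF assms(2)] flag_standard_keys_subset[OF assms]
  by (auto simp: standard_complex_def monomials_def)

text \<open>
  Both \<open>u + v\<close> and \<open>u + u\<close> map to twice the image of \<open>u\<close>, and they have the same weight. Hence two standard
  monomials of one fiber have a common face, although standard monomials need not be unique in their fiber.
\<close>

lemma flag_standard_add:
  assumes flag: "flag P \<sigma>" and u: "standard P \<sigma> u" and v: "standard P \<sigma> v"
    and eq: "mdeg u = mdeg v" "msum u = msum v"
  shows "standard P \<sigma> (u + v)"
proof (rule standard_if_weight_le)
  show "standard P \<sigma> (u + u)"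
    by (rule flag_standard_keys_subset[OF flag u]) (simp add: keys_add_nat)
  show "weight \<sigma> (u + v) \<le> weight \<sigma> (u + u)"
    using standard_weight_eq[OF u v eq] by (simp add: weight_add)
qed (use u v eq in \<open>auto simp: monomials_add_iff standard_in_monomials mdeg_add msum_add\<close>)

text \<open>
  The \<open>k\<close>-th power of a monomial, monomials being written additively.
\<close>

definition nfold :: "nat \<Rightarrow> 'a monomial \<Rightarrow> 'a monomial" where
  "nfold k u = ((+) u ^^ k) 0"

lemma nfold_simps [simp]: "nfold 0 u = 0" "nfold (Suc k) u = u + nfold k u"
  by (simp_all add: nfold_def)

lemma
  shows mdeg_nfold: "mdeg (nfold k u) = k * mdeg u"
    and msum_nfold: "msum (nfold k u) = real k *\<^sub>R msum u"
    and weight_nfold: "weight \<sigma> (nfold k u) = real k * weight \<sigma> u"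
    and keys_nfold: "Poly_Mapping.keys (nfold k u) \<subseteq> Poly_Mapping.keys u"
  by (induction k) (auto simp: mdeg_add msum_add weight_add keys_add_nat algebra_simps)

text \<open>
  For a lattice point \<open>x\<close> of the region, some power \<open>x\<^sup>N\<close> is in the fiber of a monomial \<open>n\<close> supported on the
  face \<open>S\<close>. Both are standard, so their weights agree and \<open>x\<^sup>N\<close> can be exchanged for \<open>n\<close> without changing
  weights. Thus \<open>N\<close>-th powers of monomials supported on \<open>S\<close> and \<open>x\<close> are standard, and so are the monomials
  themselves, being divisors. As \<open>S\<close> is a maximal face, it contains \<open>x\<close>.
\<close>

lemma lattice_points_standard_region:
  assumes flag: "flag P \<sigma>" and fin: "finite (lattice_points P)" and conv: "convex P"
    and S: "S \<in> standard_complex P \<sigma>" "\<And>T. T \<in> standard_complex P \<sigma> \<Longrightarrow> S \<subseteq> T \<Longrightarrow> T = S"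
  shows "lattice_points (convex hull S) \<subseteq> S"
proof
  fix x assume x: "x \<in> lattice_points (convex hull S)"
  have sub: "S \<subseteq> lattice_points P" and std: "\<And>u. Poly_Mapping.keys u \<subseteq> S \<Longrightarrow> standard P \<sigma> u"
    using S(1) flag_standard_complex_iff[OF flag fin] by auto
  have "convex hull S \<subseteq> P" using sub conv by (intro hull_minimal) (auto simp: lattice_points_def)
  with x have xP: "x \<in> lattice_points P" by (auto simp: lattice_points_def)
  have "finite S" using sub fin by (rule finite_subset)
  moreover have "S \<subseteq> int_lattice" "x \<in> convex hull S" "x \<in> int_lattice"
    using sub x by (auto simp: lattice_points_def)
  ultimately obtain n
    where n: "Poly_Mapping.keys n \<subseteq> S" "mdeg n > 0" "msum n = real (mdeg n) *\<^sub>R x"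
    by (rule lattice_point_of_convex_hull_multiple)
  let ?N = "mdeg n"
  have "standard P \<sigma> (Poly_Mapping.single x ?N)" using flag xP by (auto simp: flag_def)
  from standard_weight_eq[OF this std[OF n(1)]] n(3)
  have w: "real ?N * \<sigma> x = weight \<sigma> n" by simp
  have "standard P \<sigma> u" if "Poly_Mapping.keys u \<subseteq> insert x S" for u
    using that
  proof -
    define k where "k = Poly_Mapping.lookup u x"
    define v where "v = u - Poly_Mapping.single x k"
    have u: "u = v + Poly_Mapping.single x k"
      by (rule poly_mapping_eqI) (auto simp: v_def k_def lookup_add lookup_minus lookup_single when_def)
    have keys_v: "Poly_Mapping.keys v \<subseteq> S"
      using that by (auto simp: v_def k_def subset_iff in_keys_iff lookup_minus lookup_single when_def split: if_splits)
    have keys_uP: "Poly_Mapping.keys u \<subseteq> lattice_points P" using that xP sub by auto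
    \<comment> \<open>The \<open>N\<close>-th power of \<open>u\<close> after the exchange of \<open>x\<^sup>N\<close> for \<open>n\<close>, which happens \<open>k\<close> times.\<close>
    let ?s = "nfold ?N v + nfold k n"
    have "Poly_Mapping.keys ?s \<subseteq> S"
      using keys_v n(1) keys_nfold[of ?N v] keys_nfold[of k n] by (auto simp: keys_add_nat)
    then have s: "standard P \<sigma> ?s" by (rule std)
    have "standard P \<sigma> (nfold ?N u)"
    proof (rule standard_if_weight_le[OF s])
      show "nfold ?N u \<in> monomials P"
        using keys_uP keys_nfold[of ?N u] by (auto simp: monomials_def)
    qed (auto simp: u mdeg_nfold msum_nfold weight_nfold mdeg_add msum_add weight_add n(3) w[symmetric]
        algebra_simps)
    moreover obtain m where "?N = Suc m" using n(2) gr0_implies_Suc by blast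
    ultimately show ?thesis using standard_addD[of P \<sigma> u "nfold m u"] by simp
  qed
  then have "insert x S \<in> standard_complex P \<sigma>"
    using flag_standard_complex_iff[OF flag fin] sub xP by auto
  with S(2) show "x \<in> S" by blast
qed

lemma standard_in_region:
  assumes "flag P \<sigma>" "finite (lattice_points P)" "convex P"
    and R: "R \<in> standard_regions P \<sigma>" and u: "u \<in> monomials R"
  shows "standard P \<sigma> u"
proof -
  obtain S where S: "R = convex hull S" "S \<in> standard_complex P \<sigma>"
    "\<And>T. T \<in> standard_complex P \<sigma> \<Longrightarrow> S \<subseteq> T \<Longrightarrow> T = S"
    using R by (auto simp: standard_regions_def)
  have "lattice_points R \<subseteq> S"
    unfolding S(1) by (rule lattice_points_standard_region[OF assms(1-3) S(2,3)])
  then show ?thesis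
    using u S(2) flag_standard_complex_iff[OF assms(1,2)] by (auto simp: monomials_def)
qed

text \<open>
  The support of the product is a face, and the region is spanned by a maximal face above it. So the
  difference of two standard monomials of one fiber is a standard relation.
\<close>

lemma standard_pair_in_region:
  assumes flag: "flag P \<sigma>" and fin: "finite (lattice_points P)"
    and u: "standard P \<sigma> u" and v: "standard P \<sigma> v" and eq: "mdeg u = mdeg v" "msum u = msum v"
  obtains R where "R \<in> standard_regions P \<sigma>" "u \<in> monomials R" "v \<in> monomials R"
proof -
  let ?S0 = "Poly_Mapping.keys (u + v)"
  let ?F = "{S \<in> standard_complex P \<sigma>. ?S0 \<subseteq> S}"
  have mem: "?S0 \<in> ?F"
    using flag_keys_in_standard_complex[OF flag flag_standard_add[OF flag u v eq]] by simp
  have "finite ?F"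
    by (rule finite_subset[of _ "Pow (lattice_points P)"]) (auto simp: standard_complex_def fin)
  from finite_has_maximal2[OF this mem]
  obtain S where S: "S \<in> ?F" "\<And>T. T \<in> ?F \<Longrightarrow> S \<subseteq> T \<Longrightarrow> S = T" by auto
  show thesis
  proof
    show "convex hull S \<in> standard_regions P \<sigma>" using S by (force simp: standard_regions_def)
    have "S \<subseteq> lattice_points (convex hull S)"
      using S(1) hull_subset[of S convex] by (auto simp: standard_complex_def lattice_points_def)
    then show "u \<in> monomials (convex hull S)" "v \<in> monomials (convex hull S)"
      using S(1) by (auto simp: monomials_def keys_add_nat)
  qed
qed

section \<open>Ideals generated by binomials\<close>

text \<open>
  A linear functional. If \<open>C\<close> is a union of classes of a congruence of monomials, it vanishes on
  differences of congruent monomials.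
\<close>

definition class_sum :: "'a monomial set \<Rightarrow> 'a polynomial \<Rightarrow> complex" where
  "class_sum C p = (\<Sum>u\<in>Poly_Mapping.keys p. if u \<in> C then Poly_Mapping.lookup p u else 0)"

lemma class_sum_superset:
  assumes "finite A" "Poly_Mapping.keys p \<subseteq> A"
  shows "class_sum C p = (\<Sum>u\<in>A. if u \<in> C then Poly_Mapping.lookup p u else 0)"
  unfolding class_sum_def using assms by (intro sum.mono_neutral_left) (auto simp: in_keys_iff)

lemma class_sum_add: "class_sum C (p + q) = class_sum C p + class_sum C q"
  using keys_add[of p q]
  by (simp add: class_sum_superset[of "Poly_Mapping.keys p \<union> Poly_Mapping.keys q"] 
      flip: sum.distrib) (auto simp: lookup_add intro!: sum.cong)

lemma class_sum_0 [simp]: "class_sum C 0 = 0"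
  by (simp add: class_sum_def)

lemma class_sum_uminus: "class_sum C (- p) = - class_sum C p"
  using class_sum_add[of C p "- p"] by (simp add: eq_neg_iff_add_eq_0 add.commute)

lemma class_sum_sum: "class_sum C (sum f A) = (\<Sum>a\<in>A. class_sum C (f a))"
  by (induction A rule: infinite_finite_induct) (auto simp: class_sum_add)

lemma class_sum_single: "class_sum C (Poly_Mapping.single u c) = (if u \<in> C then c else 0)"
  by (simp add: class_sum_superset[of "{u}"])

lemma class_sum_mult:
  "class_sum C (q * p) =
    (\<Sum>s\<in>Poly_Mapping.keys q. Poly_Mapping.lookup q s * class_sum {t. s + t \<in> C} p)"
proof -
  have "q * p = (\<Sum>s\<in>Poly_Mapping.keys q. \<Sum>t\<in>Poly_Mapping.keys p.
      Poly_Mapping.single (s + t) (Poly_Mapping.lookup q s * Poly_Mapping.lookup p t))"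
    by (subst (1) polynomial_expand[of q], subst (1) polynomial_expand[of p])
       (simp add: sum_product mult_single)
  then have "class_sum C (q * p) = (\<Sum>s\<in>Poly_Mapping.keys q. \<Sum>t\<in>Poly_Mapping.keys p.
      if s + t \<in> C then Poly_Mapping.lookup q s * Poly_Mapping.lookup p t else 0)"
    by (simp only: class_sum_sum class_sum_single)
  then show ?thesis
    by (simp add: class_sum_def[of _ p] sum_distrib_left if_distrib cong: if_cong)
qed

text \<open>
  This turns membership of a binomial in an ideal generated by binomials into a statement about
  monomials, to be used with a congruence \<open>R\<close> made of liftable replacements. The polynomials whose coefficients add up to \<open>0\<close> over every union of equivalence classes form an ideal: a
  monomial factor \<open>s\<close> turns the functional of such a union into that of another one. The functional of the
  class of \<open>u\<close> then tells that \<open>v\<close> belongs to this class.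
\<close>

lemma binomial_ideal_equiv:
  assumes R: "equivp R" and trans_inv: "\<And>s t u. R t u \<Longrightarrow> R (s + t) (s + u)"
    and G: "G \<subseteq> carrier (poly_algebra P)"
      "\<And>g. g \<in> G \<Longrightarrow> \<exists>a b. g = monomial_diff a b \<and> R a b"
    and mem: "monomial_diff u v \<in> Idl\<^bsub>poly_algebra P\<^esub> G"
  shows "R u v"
proof -
  interpret cring "poly_algebra P" by (rule cring_poly_algebra)
  define saturated where "saturated C \<longleftrightarrow> (\<forall>a b. R a b \<longrightarrow> (a \<in> C \<longleftrightarrow> b \<in> C))" for C
  let ?J = "{p \<in> carrier (poly_algebra P). \<forall>C. saturated C \<longrightarrow> class_sum C p = 0}"
  have mult: "q * p \<in> ?J" if p: "p \<in> ?J" and q: "q \<in> carrier (poly_algebra P)" for p q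
  proof -
    have "q * p \<in> carrier (poly_algebra P)"
      using p q m_closed[of q p] by (simp add: poly_algebra_def)
    moreover have "class_sum C (q * p) = 0" if C: "saturated C" for C
    proof -
      have "saturated {t. s + t \<in> C}" for s
        using C trans_inv unfolding saturated_def by blast
      then show ?thesis using p by (simp add: class_sum_mult)
    qed
    ultimately show ?thesis by simp
  qed
  have "ideal ?J (poly_algebra P)"
  proof (rule idealI)
    show "subgroup ?J (add_monoid (poly_algebra P))"
    proof (rule add.subgroupI)
      fix p assume "p \<in> ?J"
      then have p: "- p \<in> ?J" by (simp add: poly_algebra_def class_sum_uminus)
      have "\<ominus>\<^bsub>poly_algebra P\<^esub> p = - p"
        by (rule minus_equality) (use \<open>p \<in> ?J\<close> p in \<open>auto simp: poly_algebra_def\<close>)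
      with p show "\<ominus>\<^bsub>poly_algebra P\<^esub> p \<in> ?J" by simp
    next
      fix p q assume "p \<in> ?J" "q \<in> ?J"
      then show "p \<oplus>\<^bsub>poly_algebra P\<^esub> q \<in> ?J"
        using keys_add[of p q] by (auto simp: poly_algebra_def class_sum_add)
    next
      have "0 \<in> ?J" by (simp add: poly_algebra_def)
      then show "?J \<noteq> {}" by blast
    qed auto
  next
    fix p q assume pq: "p \<in> ?J" "q \<in> carrier (poly_algebra P)"
    from mult[OF this] show "q \<otimes>\<^bsub>poly_algebra P\<^esub> p \<in> ?J" by (simp add: poly_algebra_def)
    with pq show "p \<otimes>\<^bsub>poly_algebra P\<^esub> q \<in> ?J" using m_comm[of p q] by auto
  qed (rule ring_axioms)
  moreover have "G \<subseteq> ?J"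
  proof
    fix g assume g: "g \<in> G"
    then obtain a b where ab: "g = monomial_diff a b" "R a b" using G(2) by blast
    have "class_sum C g = 0" if "saturated C" for C
      using ab that class_sum_add[of C g "Poly_Mapping.single b 1"]
      by (auto simp: class_sum_single saturated_def split: if_splits)
    with g G(1) show "g \<in> ?J" by auto
  qed
  ultimately have "Idl\<^bsub>poly_algebra P\<^esub> G \<subseteq> ?J" by (rule genideal_minimal)
  with mem have J: "monomial_diff u v \<in> ?J" by blast
  have "saturated {t. R u t}"
    using R unfolding saturated_def by (metis equivp_symp equivp_transp mem_Collect_eq)
  with J have "class_sum {t. R u t} (monomial_diff u v) = 0" by blast
  then show ?thesis
    using class_sum_add[of "{t. R u t}" "monomial_diff u v" "Poly_Mapping.single v 1"] equivp_reflp[OF R, of u]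
    by (auto simp: class_sum_single split: if_splits)
qed

section \<open>Monomials linked by relations of bounded degree\<close>

lemma
  assumes "ideal J (poly_algebra P)"
  shows poly_ideal_0: "0 \<in> J"
    and poly_ideal_add: "p \<in> J \<Longrightarrow> q \<in> J \<Longrightarrow> p + q \<in> J"
    and poly_ideal_mult: "p \<in> J \<Longrightarrow> Poly_Mapping.keys r \<subseteq> monomials P \<Longrightarrow> r * p \<in> J"
    and poly_ideal_uminus: "p \<in> J \<Longrightarrow> - p \<in> J"
proof -
  interpret ideal J "poly_algebra P" by fact
  show "0 \<in> J" "p \<in> J \<Longrightarrow> q \<in> J \<Longrightarrow> p + q \<in> J"
    using additive_subgroup.zero_closed[OF is_additive_subgroup]
      additive_subgroup.a_closed[OF is_additive_subgroup, of p q] by (auto simp: poly_algebra_def)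
  show mult: "p \<in> J \<Longrightarrow> Poly_Mapping.keys r \<subseteq> monomials P \<Longrightarrow> r * p \<in> J" for r
    using I_l_closed[of p r] by (auto simp: poly_algebra_def)
  show "- p \<in> J" if "p \<in> J"
    using mult[OF that, of "- 1"] by (simp add: monomials_def)
qed

text \<open>
  The congruence of monomials modulo the part of the toric ideal that is generated in degree at most
  \<open>k\<close>. The toric ideal is generated in degree at most \<open>k\<close> once it relates all monomials of each fiber.
\<close>

definition linked :: "'a::euclidean_space set \<Rightarrow> nat \<Rightarrow> 'a monomial \<Rightarrow> 'a monomial \<Rightarrow> bool" where
  "linked P k u v \<longleftrightarrow> u \<in> monomials P \<and> v \<in> monomials P \<and>
     monomial_diff u v \<in> Idl\<^bsub>poly_algebra P\<^esub> {p \<in> toric_ideal P. deg_le k p}"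

lemma
  shows ideal_low_degree: "ideal (Idl\<^bsub>poly_algebra P\<^esub> {p \<in> toric_ideal P. deg_le k p}) (poly_algebra P)"
    and low_degree_subset: "{p \<in> toric_ideal P. deg_le k p} \<subseteq> Idl\<^bsub>poly_algebra P\<^esub> {p \<in> toric_ideal P. deg_le k p}"
    and low_degree_subset_toric_ideal: "Idl\<^bsub>poly_algebra P\<^esub> {p \<in> toric_ideal P. deg_le k p} \<subseteq> toric_ideal P"
proof -
  interpret cring "poly_algebra P" by (rule cring_poly_algebra)
  have sub: "{p \<in> toric_ideal P. deg_le k p} \<subseteq> carrier (poly_algebra P)"
    by (auto simp: toric_ideal_iff poly_algebra_def)
  show "ideal (Idl\<^bsub>poly_algebra P\<^esub> {p \<in> toric_ideal P. deg_le k p}) (poly_algebra P)"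
    using sub by (rule genideal_ideal)
  show "{p \<in> toric_ideal P. deg_le k p} \<subseteq> Idl\<^bsub>poly_algebra P\<^esub> {p \<in> toric_ideal P. deg_le k p}"
    using sub by (rule genideal_self)
  show "Idl\<^bsub>poly_algebra P\<^esub> {p \<in> toric_ideal P. deg_le k p} \<subseteq> toric_ideal P"
    by (rule genideal_minimal[OF ideal_toric_ideal]) auto
qed

lemma linked_refl: "u \<in> monomials P \<Longrightarrow> linked P k u u"
  using poly_ideal_0[OF ideal_low_degree] by (simp add: linked_def)

lemma linked_sym: "linked P k u v \<Longrightarrow> linked P k v u"
  using poly_ideal_uminus[OF ideal_low_degree, of "monomial_diff u v" P k] by (simp add: linked_def)

lemma linked_trans: "linked P k u v \<Longrightarrow> linked P k v w \<Longrightarrow> linked P k u w"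
  using poly_ideal_add[OF ideal_low_degree, of "monomial_diff u v" P k "monomial_diff v w"]
  by (simp add: linked_def)

lemma linked_add:
  assumes "linked P k u v" "c \<in> monomials P"
  shows "linked P k (c + u) (c + v)"
proof -
  have "Poly_Mapping.single c 1 * monomial_diff u v = monomial_diff (c + u) (c + v)"
    by (simp add: right_diff_distrib mult_single)
  with poly_ideal_mult[OF ideal_low_degree, of "monomial_diff u v" P k "Poly_Mapping.single c 1"] assms
  show ?thesis by (simp add: linked_def monomials_add_iff)
qed

lemma linked_low_degree:
  assumes "u \<in> monomials P" "v \<in> monomials P" "mdeg u = mdeg v" "msum u = msum v" "mdeg u \<le> k"
  shows "linked P k u v"
proof -
  have "monomial_diff u v \<in> toric_ideal P" "deg_le k (monomial_diff u v)"
    using assms by (auto simp: monomial_diff_in_toric_ideal_iff deg_le_def keys_monomial_diff split: if_splits)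
  then show ?thesis using low_degree_subset[of P k] assms by (auto simp: linked_def)
qed

lemma linked_same_image:
  assumes "linked P k u v"
  shows "u \<in> monomials P" "v \<in> monomials P" "mdeg u = mdeg v" "msum u = msum v"
  using assms low_degree_subset_toric_ideal[of P k] monomial_diff_in_toric_ideal_iff[of u P v]
  by (auto simp: linked_def)

text \<open>
  The toric ideal is spanned by differences of monomials of the same fiber: subtracting a multiple of
  such a difference removes a monomial from a given element, without introducing a new one.
\<close>

lemma toric_ideal_generated_if_linked:
  assumes linked: "\<And>u v. u \<in> monomials P \<Longrightarrow> v \<in> monomials P \<Longrightarrow> mdeg u = mdeg v \<Longrightarrow> msum u = msum v \<Longrightarrow>
    linked P k u v"
  shows "ideal_generated_deg_le P (toric_ideal P) k"
proof -
  let ?J = "Idl\<^bsub>poly_algebra P\<^esub> {p \<in> toric_ideal P. deg_le k p}"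
  have "p \<in> ?J" if "p \<in> toric_ideal P" for p
    using that
  proof (induction "card (Poly_Mapping.keys p)" arbitrary: p rule: less_induct)
    case less
    show ?case
    proof (cases "p = 0")
      case True
      then show ?thesis using poly_ideal_0[OF ideal_low_degree] by simp
    next
      case False
      then obtain u where u: "u \<in> Poly_Mapping.keys p" by (metis keys_eq_empty ex_in_conv)
      with less.prems obtain v where v: "v \<in> Poly_Mapping.keys p" "v \<noteq> u" "mdeg v = mdeg u" "msum v = msum u"
        by (rule toric_ideal_same_image)
      have mon: "u \<in> monomials P" "v \<in> monomials P" using less.prems u v(1) by (auto simp: toric_ideal_iff)
      define q where "q = Poly_Mapping.single 0 (Poly_Mapping.lookup p u) * monomial_diff u v"
      have q: "q = Poly_Mapping.single u (Poly_Mapping.lookup p u) - Poly_Mapping.single v (Poly_Mapping.lookup p u)"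
        by (simp add: q_def right_diff_distrib mult_single)
      have zero_mon: "Poly_Mapping.keys (Poly_Mapping.single 0 (Poly_Mapping.lookup p u)) \<subseteq> monomials P"
        by (auto simp: monomials_def)
      have "monomial_diff u v \<in> ?J" using linked[of u v] mon v by (simp add: linked_def)
      then have qJ: "q \<in> ?J"
        unfolding q_def by (rule poly_ideal_mult[OF ideal_low_degree _ zero_mon])
      then have "- q \<in> toric_ideal P"
        using low_degree_subset_toric_ideal[of P k] poly_ideal_uminus[OF ideal_toric_ideal] by blast
      with less.prems have "p - q \<in> toric_ideal P"
        using poly_ideal_add[OF ideal_toric_ideal, of p P "- q"] by simp
      moreover have "Poly_Mapping.keys (p - q) \<subset> Poly_Mapping.keys p"
        using u v(1,2) by (auto simp: q in_keys_iff lookup_minus lookup_single when_def split: if_splits)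
      then have "card (Poly_Mapping.keys (p - q)) < card (Poly_Mapping.keys p)"
        by (intro psubset_card_mono) auto
      ultimately have "p - q \<in> ?J" using less.hyps by blast
      from poly_ideal_add[OF ideal_low_degree this qJ] show ?thesis by simp
    qed
  qed
  then have "toric_ideal P = ?J" using low_degree_subset_toric_ideal[of P k] by blast
  then show ?thesis unfolding ideal_generated_deg_le_def
    by (intro exI[of _ "{p \<in> toric_ideal P. deg_le k p}"]) auto
qed

section \<open>Lifting standard relations\<close>

text \<open>
  Replacing one projection of \<open>w\<close> by another standard monomial of its fiber costs only relations of
  degree at most \<open>K\<close>. The hypothesis \<open>exchange\<close> lifts a replacement directly, but with a relation of the degree
  of \<open>w\<close>. Applied to divisors of \<open>w\<close> it lifts the generating standard relations, and the monomials
  connected by liftable replacements form a congruence, so that all consequences of the generators lift too.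

  With \<open>f\<close> and \<open>g\<close> the two projections of a fiber product, in either order, this treats both factors.
\<close>

lemma lift_standard_relations:
  fixes P :: "'a::euclidean_space set" and F :: "'z::euclidean_space set"
    and f :: "'z \<Rightarrow> 'a" and g :: "'z \<Rightarrow> 'b"
  assumes P: "flag P \<sigma>" "finite (lattice_points P)" "convex P"
    and gen: "standard_relations_generated_deg_le P \<sigma> k" and "k \<le> K"
    and exchange: "\<And>w a. w \<in> monomials F \<Longrightarrow> standard P \<sigma> (push_monomial f w) \<Longrightarrow> standard P \<sigma> a \<Longrightarrow>
        mdeg a = mdeg w \<Longrightarrow> msum a = msum (push_monomial f w) \<Longrightarrow>
        \<exists>w'\<in>monomials F. push_monomial f w' = a \<and> push_monomial g w' = push_monomial g w \<and> msum w' = msum w"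
    and w: "w \<in> monomials F" "standard P \<sigma> (push_monomial f w)"
    and u: "standard P \<sigma> u" "mdeg u = mdeg w" "msum u = msum (push_monomial f w)"
  shows "\<exists>w'. linked F K w w' \<and> push_monomial f w' = u \<and> push_monomial g w' = push_monomial g w"
proof -
  \<comment> \<open>Quantifying over all monomials over \<open>a\<close>, not just \<open>w\<close>, makes \<open>L\<close> compatible with multiplication.\<close>
  define L where "L a b \<longleftrightarrow> (\<forall>w\<in>monomials F. push_monomial f w = a \<longrightarrow>
      (\<exists>w'. linked F K w w' \<and> push_monomial f w' = b \<and> push_monomial g w' = push_monomial g w))" for a b
  define R where "R a b \<longleftrightarrow> L a b \<and> L b a" for a b
  have L_refl: "L a a" for a unfolding L_def using linked_refl by blast
  have L_trans: "L a c" if "L a b" "L b c" for a b c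
    unfolding L_def
  proof (intro ballI impI)
    fix w assume w: "w \<in> monomials F" "push_monomial f w = a"
    with that(1) obtain w1 where w1: "linked F K w w1" "push_monomial f w1 = b"
      "push_monomial g w1 = push_monomial g w" unfolding L_def by blast
    with that(2) obtain w2 where "linked F K w1 w2" "push_monomial f w2 = c"
      "push_monomial g w2 = push_monomial g w1" unfolding L_def using linked_same_image(2) by blast
    with w1 show "\<exists>w'. linked F K w w' \<and> push_monomial f w' = c \<and> push_monomial g w' = push_monomial g w"
      using linked_trans by metis
  qed
  have L_add: "L (c + a) (c + b)" if "L a b" for a b c
    unfolding L_def
  proof (intro ballI impI)
    fix w assume w: "w \<in> monomials F" "push_monomial f w = c + a"
    from w(2) obtain r v where rv: "w = r + v" "push_monomial f r = c" "push_monomial f v = a"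
      by (rule push_monomial_split)
    with w(1) have mon: "r \<in> monomials F" "v \<in> monomials F" by (auto simp: monomials_add_iff)
    with that rv(3) obtain v' where "linked F K v v'" "push_monomial f v' = b"
      "push_monomial g v' = push_monomial g v" unfolding L_def by blast
    then show "\<exists>w'. linked F K w w' \<and> push_monomial f w' = c + b \<and> push_monomial g w' = push_monomial g w"
      using linked_add[OF _ mon(1)] rv by (intro exI[of _ "r + v'"]) (auto simp: push_monomial_add)
  qed
  have L_low: "L a b"
    if ab: "standard P \<sigma> a" "standard P \<sigma> b" "mdeg a = mdeg b" "msum a = msum b" "mdeg a \<le> k" for a b
    unfolding L_def
  proof (intro ballI impI)
    fix w assume w: "w \<in> monomials F" "push_monomial f w = a"
    then have deg: "mdeg w = mdeg a" by (metis mdeg_push_monomial)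
    obtain w' where w': "w' \<in> monomials F" "push_monomial f w' = b"
      "push_monomial g w' = push_monomial g w" "msum w' = msum w"
      using exchange[OF w(1), unfolded w(2), OF ab(1,2)] ab(3,4) deg by metis
    moreover have "mdeg w' = mdeg w" using w'(2) deg ab(3) by (metis mdeg_push_monomial)
    ultimately have "linked F K w w'"
      using w(1) deg ab(5) \<open>k \<le> K\<close> by (intro linked_low_degree) auto
    with w' show "\<exists>w'. linked F K w w' \<and> push_monomial f w' = b \<and> push_monomial g w' = push_monomial g w"
      by blast
  qed
  \<comment> \<open>The given replacement is a standard relation, so it is a consequence of those of low degree.\<close>
  let ?G = "{r \<in> standard_relations P \<sigma>. deg_le k r}"
  have "R (push_monomial f w) u"
  proof (rule binomial_ideal_equiv)
    show "equivp R"
      using L_refl L_trans by (intro equivpI) (auto simp: R_def reflp_def symp_def transp_def)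
    show "R (c + a) (c + b)" if "R a b" for a b c using that L_add by (simp add: R_def)
    show "?G \<subseteq> carrier (poly_algebra P)"
      by (auto simp: standard_relations_def toric_ideal_iff poly_algebra_def)
    show "\<exists>a b. r = monomial_diff a b \<and> R a b" if r: "r \<in> ?G" for r
    proof -
      obtain a b S where ab: "r = monomial_diff a b" "r \<in> toric_ideal P"
        and S: "S \<in> standard_regions P \<sigma>" "a \<in> monomials S" "b \<in> monomials S"
        using r by (auto simp: standard_relations_def)
      have std: "standard P \<sigma> a" "standard P \<sigma> b" using standard_in_region[OF P S(1)] S(2,3) by auto
      then have "mdeg a = mdeg b \<and> msum a = msum b"
        using ab monomial_diff_in_toric_ideal_iff standard_in_monomials by blast
      moreover have "a = b \<or> mdeg a \<le> k"
        using r by (auto simp: deg_le_def ab(1) keys_monomial_diff split: if_splits)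
      ultimately have "R a b" using L_low std L_refl by (auto simp: R_def)
      with ab(1) show ?thesis by blast
    qed
    obtain S where "S \<in> standard_regions P \<sigma>" "push_monomial f w \<in> monomials S" "u \<in> monomials S"
      using standard_pair_in_region[OF P(1,2) w(2) u(1)] u(2,3) by auto
    moreover have "monomial_diff (push_monomial f w) u \<in> toric_ideal P"
      using w u by (simp add: monomial_diff_in_toric_ideal_iff standard_in_monomials)
    ultimately have "monomial_diff (push_monomial f w) u \<in> standard_relations P \<sigma>"
      by (auto simp: standard_relations_def)
    then show "monomial_diff (push_monomial f w) u \<in> Idl\<^bsub>poly_algebra P\<^esub> ?G"
      using gen by (auto simp: standard_relations_generated_deg_le_def)
  qed
  then show ?thesis using w(1) by (auto simp: R_def L_def)
qed

section \<open>Fiber products\<close>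

locale flag_fiber_product =
  fixes P1 :: "'a::euclidean_space set" and \<sigma>1 :: "'a \<Rightarrow> real"
    and P2 :: "'b::euclidean_space set" and \<sigma>2 :: "'b \<Rightarrow> real"
    and Q :: "'c::euclidean_space set" and \<sigma> :: "'c \<Rightarrow> real"
    and \<pi>1 :: "'a \<Rightarrow> 'c" and \<pi>2 :: "'b \<Rightarrow> 'c"
    and F :: "('a \<times> 'b) set" and \<tau> :: "'a \<times> 'b \<Rightarrow> real"
  assumes morphism1: "is_morphism \<pi>1 (P1, \<sigma>1) (Q, \<sigma>)"
    and morphism2: "is_morphism \<pi>2 (P2, \<sigma>2) (Q, \<sigma>)"
    and flag1: "flag P1 \<sigma>1" and flag2: "flag P2 \<sigma>2"
    and unique: "unique_standard_monomials Q \<sigma>"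
    and fiber_product: "(F, \<tau>) = fiber_product \<pi>1 (P1, \<sigma>1) \<pi>2 (P2, \<sigma>2)"
begin

lemma linear1: "linear \<pi>1" and linear2: "linear \<pi>2"
  using morphism1 morphism2 by (auto simp: is_morphism_def)

lemma finite1: "finite (lattice_points P1)" and finite2: "finite (lattice_points P2)"
  using morphism1 morphism2 by (auto simp: is_morphism_def is_object_def finite_lattice_points)

lemma convex1: "convex P1" and convex2: "convex P2"
  using morphism1 morphism2 by (auto simp: is_morphism_def is_object_def lattice_polytope_def)

lemma standard_push1: "standard P1 \<sigma>1 u \<Longrightarrow> standard Q \<sigma> (push_monomial \<pi>1 u)"
  and standard_push2: "standard P2 \<sigma>2 v \<Longrightarrow> standard Q \<sigma> (push_monomial \<pi>2 v)"
  using morphism1 morphism2 by (auto simp: is_morphism_def)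

lemma lattice_points_F:
  "(x, y) \<in> lattice_points F \<longleftrightarrow> x \<in> lattice_points P1 \<and> y \<in> lattice_points P2 \<and> \<pi>1 x = \<pi>2 y"
  using fiber_product by (auto simp: fiber_product_def lattice_points_def int_lattice_Times)

lemma finite_lattice_points_F: "finite (lattice_points F)"
  by (rule finite_subset[of _ "lattice_points P1 \<times> lattice_points P2"])
    (auto simp: lattice_points_F finite1 finite2)

lemma
  assumes "w \<in> monomials F"
  shows push_fst_in_monomials: "push_monomial fst w \<in> monomials P1"
    and push_snd_in_monomials: "push_monomial snd w \<in> monomials P2"
    and push_fst_snd_eq: "push_monomial \<pi>1 (push_monomial fst w) = push_monomial \<pi>2 (push_monomial snd w)"
  using assms by (auto simp: monomials_def keys_push_monomial lattice_points_F push_monomial_comp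
      intro!: push_monomial_cong)

lemma msum_F: "msum (w :: ('a \<times> 'b) monomial) = (msum (push_monomial fst w), msum (push_monomial snd w))"
  by (simp add: msum_push_monomial linear_fst linear_snd)

lemma weight_F: "weight \<tau> w = weight \<sigma>1 (push_monomial fst w) + weight \<sigma>2 (push_monomial snd w)"
proof -
  have "\<tau> z = \<sigma>1 (fst z) + \<sigma>2 (snd z)" for z
    using fiber_product by (auto simp: fiber_product_def case_prod_beta)
  then show ?thesis
    by (induction w rule: monomial_induct) (auto simp: weight_add push_monomial_add)
qed

text \<open>
  The points of \<open>a\<close> and \<open>d\<close> can be matched over their common image; each matched pair is a lattice point of
  the fiber product.
\<close>

lemma glue_monomials:
  assumes "a \<in> monomials P1" "d \<in> monomials P2" "push_monomial \<pi>1 a = push_monomial \<pi>2 d"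
  obtains w where "w \<in> monomials F" "push_monomial fst w = a" "push_monomial snd w = d"
  using assms
proof (induction a arbitrary: d thesis rule: monomial_induct)
  case zero
  have "mdeg d = mdeg (push_monomial \<pi>1 (0 :: 'a monomial))"
    using zero.prems(4) mdeg_push_monomial[of \<pi>2 d] by simp
  then have "d = 0" by simp
  then show ?case by (intro zero.prems(1)[of 0]) (auto simp: monomials_def)
next
  case (add x a)
  have "\<pi>1 x \<in> Poly_Mapping.keys (push_monomial \<pi>2 d)"
    unfolding add.prems(4)[symmetric] by (simp add: push_monomial_add keys_add_nat)
  then obtain y where y: "y \<in> Poly_Mapping.keys d" "\<pi>1 x = \<pi>2 y" by (auto simp: keys_push_monomial)
  from y(1) obtain d' where d': "d = point_monomial y + d'" by (rule split_off_point)
  have "(x, y) \<in> lattice_points F"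
    using add.prems(2,3) y by (auto simp: lattice_points_F monomials_def keys_add_nat)
  then have xy: "point_monomial (x, y) \<in> monomials F" by (simp add: monomials_def)
  have "push_monomial \<pi>1 a = push_monomial \<pi>2 d'"
    using add.prems(4) y(2) by (simp add: d' push_monomial_add)
  then obtain w where "w \<in> monomials F" "push_monomial fst w = a" "push_monomial snd w = d'"
    using add.IH[of d'] add.prems(2,3) by (auto simp: d' monomials_add_iff)
  with xy show ?case
    by (intro add.prems(1)[of "point_monomial (x, y) + w"])
      (auto simp: monomials_add_iff push_monomial_add d')
qed

text \<open>
  The two monomials pair up the same points in different ways, always over a common image in \<open>Q\<close>. Any two
  pairings differ by swaps \<open>(x, y') (x', y) \<rightarrow> (x, y) (x', y')\<close>, which are quadratic relations.
\<close>

lemma linked_same_projections: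
  assumes "2 \<le> k" "w \<in> monomials F" "w' \<in> monomials F"
    and "push_monomial fst w = push_monomial fst w'" "push_monomial snd w = push_monomial snd w'"
  shows "linked F k w w'"
  using assms(2-)
proof (induction w arbitrary: w' rule: monomial_induct)
  case zero
  have "mdeg w' = mdeg (push_monomial fst (0 :: ('a \<times> 'b) monomial))"
    using zero.prems(3) mdeg_push_monomial[of fst w'] by simp
  then show ?case using linked_refl[OF zero.prems(1)] by simp
next
  case (add z w)
  obtain x y where z: "z = (x, y)" by (cases z)
  have "x \<in> Poly_Mapping.keys (push_monomial fst w')" "y \<in> Poly_Mapping.keys (push_monomial snd w')"
    unfolding add.prems(3,4)[symmetric] by (simp_all add: push_monomial_add keys_add_nat z)
  then obtain x' y' where y': "(x, y') \<in> Poly_Mapping.keys w'" and x': "(x', y) \<in> Poly_Mapping.keys w'"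
    by (auto simp: keys_push_monomial)
  have zF: "point_monomial z \<in> monomials F" and wF: "w \<in> monomials F"
    using add.prems(1) by (auto simp: monomials_add_iff)
  obtain r where r: "w' = point_monomial (x, y') + r" using y' by (rule split_off_point)
  show ?case
  proof (cases "y' = y")
    case True
    have "linked F k w r"
      using add.prems by (intro add.IH) (auto simp: r True z push_monomial_add monomials_add_iff)
    then show ?thesis unfolding r True z by (rule linked_add) (use zF z in simp)
  next
    case False
    with x' have "(x', y) \<in> Poly_Mapping.keys r" by (auto simp: r keys_add_nat)
    then obtain s where s: "r = point_monomial (x', y) + s" by (rule split_off_point)
    have "(x, y) \<in> lattice_points F" "(x, y') \<in> lattice_points F" "(x', y) \<in> lattice_points F"
      using zF x' y' add.prems(2) z by (auto simp: monomials_def)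
    then have "(x', y') \<in> lattice_points F" by (auto simp: lattice_points_F)
    then have x'y': "point_monomial (x', y') \<in> monomials F" by (simp add: monomials_def)
    have sF: "s \<in> monomials F" and mF: "point_monomial (x, y') \<in> monomials F" "point_monomial (x', y) \<in> monomials F"
      using add.prems(2) by (auto simp: r s monomials_add_iff)
    have "linked F k w (point_monomial (x', y') + s)"
    proof (rule add.IH[OF wF])
      show "point_monomial (x', y') + s \<in> monomials F" using x'y' sF by (simp add: monomials_add_iff)
      have "push_monomial fst (point_monomial z + w) = push_monomial fst w'" by fact
      then show "push_monomial fst w = push_monomial fst (point_monomial (x', y') + s)"
        by (simp add: z r s push_monomial_add)
      have "push_monomial snd (point_monomial z + w) = push_monomial snd w'" by fact
      then have "point_monomial y + push_monomial snd w =
          point_monomial y + push_monomial snd (point_monomial (x', y') + s)"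
        by (simp add: z r s push_monomial_add add_ac)
      then show "push_monomial snd w = push_monomial snd (point_monomial (x', y') + s)" by simp
    qed
    then have "linked F k (point_monomial z + w) (point_monomial z + (point_monomial (x', y') + s))"
      using zF by (rule linked_add)
    moreover have "linked F k (point_monomial z + point_monomial (x', y'))
        (point_monomial (x, y') + point_monomial (x', y))"
      using zF x'y' mF assms(1)
      by (intro linked_low_degree) (auto simp: monomials_add_iff mdeg_add msum_add z)
    from linked_add[OF this sF]
    have "linked F k (point_monomial z + (point_monomial (x', y') + s)) w'"
      by (simp add: r s add_ac)
    ultimately show ?thesis by (rule linked_trans)
  qed
qed

text \<open>
  Uniqueness in \<open>Q\<close> forces independently chosen standard monomials of \<open>P1\<close> and \<open>P2\<close>
  to have the same image, so that they can be glued.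
\<close>

lemma standard_push_eq:
  assumes "standard P1 \<sigma>1 u" "standard P2 \<sigma>2 v" "mdeg u = mdeg v" "\<pi>1 (msum u) = \<pi>2 (msum v)"
  shows "push_monomial \<pi>1 u = push_monomial \<pi>2 v"
  using assms
  by (intro unique_standardD[OF unique standard_push1 standard_push2])
    (auto simp: msum_push_monomial linear1 linear2)

text \<open>
  Standard monomials chosen in the fibers of the two projections have the same image in \<open>Q\<close>, so they can be
  glued. The resulting relation has the degree of \<open>w\<close>, so it is a quadratic move only if \<open>w\<close> is quadratic.
\<close>

lemma standardize_projections:
  assumes w: "w \<in> monomials F"
  obtains w' where "w' \<in> monomials F" "mdeg w' = mdeg w" "msum w' = msum w"
    "standard P1 \<sigma>1 (push_monomial fst w')" "standard P2 \<sigma>2 (push_monomial snd w')"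
proof -
  obtain a where a: "standard P1 \<sigma>1 a" "mdeg a = mdeg w" "msum a = msum (push_monomial fst w)"
    using ex_standard[OF finite1 push_fst_in_monomials[OF w]] by auto
  obtain d where d: "standard P2 \<sigma>2 d" "mdeg d = mdeg w" "msum d = msum (push_monomial snd w)"
    using ex_standard[OF finite2 push_snd_in_monomials[OF w]] by auto
  have "\<pi>1 (msum a) = \<pi>2 (msum d)"
    unfolding a(3) d(3) msum_push_monomial[OF linear1, symmetric] msum_push_monomial[OF linear2, symmetric]
    by (simp only: push_fst_snd_eq[OF w])
  then have "push_monomial \<pi>1 a = push_monomial \<pi>2 d"
    using a(1,2) d(1,2) by (intro standard_push_eq) auto
  with a(1) d(1) obtain w' where w': "w' \<in> monomials F" "push_monomial fst w' = a" "push_monomial snd w' = d"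
    using glue_monomials standard_in_monomials by metis
  show thesis
  proof
    show "mdeg w' = mdeg w" using w'(2) a(2) mdeg_push_monomial[of fst w'] by simp
    show "msum w' = msum w" unfolding msum_F[of w] msum_F[of w'] using w' a d by simp
  qed (use w' a d in simp_all)
qed

lemma weight_decreases_if_not_standard:
  assumes "w \<in> monomials F" "w' \<in> monomials F" "mdeg w' = mdeg w" "msum w' = msum w"
    and std: "standard P1 \<sigma>1 (push_monomial fst w')" "standard P2 \<sigma>2 (push_monomial snd w')"
    and not_std: "\<not> standard P1 \<sigma>1 (push_monomial fst w) \<or> \<not> standard P2 \<sigma>2 (push_monomial snd w)"
  shows "weight \<tau> w' < weight \<tau> w"
proof -
  have deg: "mdeg (push_monomial fst w) = mdeg (push_monomial fst w')"
      "mdeg (push_monomial snd w) = mdeg (push_monomial snd w')"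
    using assms(3) by simp_all
  have sum: "msum (push_monomial fst w) = msum (push_monomial fst w')"
      "msum (push_monomial snd w) = msum (push_monomial snd w')"
    using assms(4) unfolding msum_F[of w] msum_F[of w'] by simp_all
  have "weight \<sigma>1 (push_monomial fst w') \<le> weight \<sigma>1 (push_monomial fst w)"
    "weight \<sigma>2 (push_monomial snd w') \<le> weight \<sigma>2 (push_monomial snd w)"
    using std assms(1) deg sum by (auto intro!: standard_weight_le push_fst_in_monomials push_snd_in_monomials)
  moreover have "\<not> weight \<sigma>1 (push_monomial fst w) \<le> weight \<sigma>1 (push_monomial fst w') \<or>
      \<not> weight \<sigma>2 (push_monomial snd w) \<le> weight \<sigma>2 (push_monomial snd w')"
    using standard_if_weight_le[OF std(1) push_fst_in_monomials[OF assms(1)] deg(1) sum(1)]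
      standard_if_weight_le[OF std(2) push_snd_in_monomials[OF assms(1)] deg(2) sum(2)] not_std by blast
  ultimately show ?thesis by (auto simp: weight_F)
qed

text \<open>
  A monomial of least weight in its \<open>linked\<close> class has standard projections. Otherwise, by flagness, a
  quadratic divisor of a projection is not standard; it lifts to a quadratic divisor of the monomial,
  and standardizing the projections of the latter would decrease the weight.
\<close>

lemma linked_to_standard:
  assumes "2 \<le> k" "w \<in> monomials F"
  obtains w' where "linked F k w w'"
    "standard P1 \<sigma>1 (push_monomial fst w')" "standard P2 \<sigma>2 (push_monomial snd w')"
proof -
  let ?C = "{v. linked F k w v}"
  have "?C \<subseteq> {v. Poly_Mapping.keys v \<subseteq> lattice_points F \<and> mdeg v = mdeg w}"
    using linked_same_image by (fastforce simp: monomials_def)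
  then have "finite ?C" by (rule finite_subset) (intro finite_monomials_of_degree finite_lattice_points_F)
  moreover have "w \<in> ?C" using assms(2) by (simp add: linked_refl)
  ultimately obtain v where v: "linked F k w v" and min: "\<And>v'. linked F k w v' \<Longrightarrow> weight \<tau> v \<le> weight \<tau> v'"
    using ex_min_if_finite[of "weight \<tau> ` ?C"] by (fastforce simp: not_less)
  have vF: "v \<in> monomials F" using v by (rule linked_same_image)
  have divisor_std: "standard P1 \<sigma>1 (push_monomial fst t) \<and> standard P2 \<sigma>2 (push_monomial snd t)"
    if t: "v = t + r" "mdeg t = 2" for t r
  proof (rule ccontr)
    assume not_std: "\<not> ?thesis"
    have mon: "t \<in> monomials F" "r \<in> monomials F" using vF by (auto simp: t(1) monomials_add_iff)
    obtain t' where t': "t' \<in> monomials F" "mdeg t' = mdeg t" "msum t' = msum t"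
      "standard P1 \<sigma>1 (push_monomial fst t')" "standard P2 \<sigma>2 (push_monomial snd t')"
      using mon(1) by (rule standardize_projections)
    have "weight \<tau> t' < weight \<tau> t"
      using weight_decreases_if_not_standard[OF mon(1) t'] not_std by blast
    moreover have "linked F k t t'"
      using mon t' t(2) assms(1) by (intro linked_low_degree) auto
    from linked_add[OF this mon(2)] have "linked F k v (r + t')" by (simp add: t(1) add.commute)
    then have "weight \<tau> v \<le> weight \<tau> (r + t')" using v linked_trans min by blast
    ultimately show False by (simp add: t(1) weight_add)
  qed
  have "standard P1 \<sigma>1 d" if d: "mdeg d = 2" "push_monomial fst v = d + e" for d e
  proof -
    obtain t r where t: "v = t + r" "push_monomial fst t = d" using d(2) by (rule push_monomial_split)
    then have "mdeg t = 2" using d(1) by (metis mdeg_push_monomial)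
    then show ?thesis using divisor_std t by blast
  qed
  then have "standard P1 \<sigma>1 (push_monomial fst v)"
    using flag1 push_fst_in_monomials[OF vF] unfolding flag_def by blast
  moreover have "standard P2 \<sigma>2 d" if d: "mdeg d = 2" "push_monomial snd v = d + e" for d e
  proof -
    obtain t r where t: "v = t + r" "push_monomial snd t = d" using d(2) by (rule push_monomial_split)
    then have "mdeg t = 2" using d(1) by (metis mdeg_push_monomial)
    then show ?thesis using divisor_std t by blast
  qed
  then have "standard P2 \<sigma>2 (push_monomial snd v)"
    using flag2 push_snd_in_monomials[OF vF] unfolding flag_def by blast
  ultimately show thesis using that v by blast
qed

text \<open>
  The first projection of \<open>w\<close> is changed into that of \<open>v\<close> by lifted standard relations of \<open>P1\<close>, then the
  second one by those of \<open>P2\<close>; quadratic swaps do the rest.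
\<close>

lemma linked_standard:
  assumes gen: "standard_relations_generated_deg_le P1 \<sigma>1 k1" "standard_relations_generated_deg_le P2 \<sigma>2 k2"
    and k: "k1 \<le> K" "k2 \<le> K" "2 \<le> K"
    and w: "w \<in> monomials F" "standard P1 \<sigma>1 (push_monomial fst w)" "standard P2 \<sigma>2 (push_monomial snd w)"
    and v: "v \<in> monomials F" "standard P1 \<sigma>1 (push_monomial fst v)" "standard P2 \<sigma>2 (push_monomial snd v)"
    and eq: "mdeg w = mdeg v" "msum w = msum v"
  shows "linked F K w v"
proof -
  have sum: "msum (push_monomial fst w) = msum (push_monomial fst v)"
      "msum (push_monomial snd w) = msum (push_monomial snd v)"
    using eq(2) unfolding msum_F[of w] msum_F[of v] by simp_all
  \<comment> \<open>By uniqueness in \<open>Q\<close> the new first projection has the same image in \<open>Q\<close> as the old one, so it can be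
  glued to the old second projection.\<close>
  have exchange1: "\<exists>t'\<in>monomials F. push_monomial fst t' = a \<and> push_monomial snd t' = push_monomial snd t \<and> msum t' = msum t"
    if t: "t \<in> monomials F" "standard P1 \<sigma>1 (push_monomial fst t)" "standard P1 \<sigma>1 a"
      "mdeg a = mdeg t" "msum a = msum (push_monomial fst t)" for t a
  proof -
    have "push_monomial \<pi>1 a = push_monomial \<pi>1 (push_monomial fst t)"
      using t by (intro unique_standardD[OF unique] standard_push1) (auto simp: msum_push_monomial linear1)
    also have "\<dots> = push_monomial \<pi>2 (push_monomial snd t)" using t(1) by (rule push_fst_snd_eq)
    finally obtain t' where "t' \<in> monomials F" "push_monomial fst t' = a" "push_monomial snd t' = push_monomial snd t"
      using glue_monomials[OF standard_in_monomials[OF t(3)] push_snd_in_monomials[OF t(1)]] by blast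
    then show ?thesis unfolding msum_F[of t] using t(5) msum_F by metis
  qed
  have exchange2: "\<exists>t'\<in>monomials F. push_monomial snd t' = a \<and> push_monomial fst t' = push_monomial fst t \<and> msum t' = msum t"
    if t: "t \<in> monomials F" "standard P2 \<sigma>2 (push_monomial snd t)" "standard P2 \<sigma>2 a"
      "mdeg a = mdeg t" "msum a = msum (push_monomial snd t)" for t a
  proof -
    have "push_monomial \<pi>1 (push_monomial fst t) = push_monomial \<pi>2 (push_monomial snd t)"
      using t(1) by (rule push_fst_snd_eq)
    also have "\<dots> = push_monomial \<pi>2 a"
      using t by (intro unique_standardD[OF unique] standard_push2) (auto simp: msum_push_monomial linear2)
    finally obtain t' where "t' \<in> monomials F" "push_monomial fst t' = push_monomial fst t" "push_monomial snd t' = a"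
      using glue_monomials[OF push_fst_in_monomials[OF t(1)] standard_in_monomials[OF t(3)]] by blast
    then show ?thesis unfolding msum_F[of t] using t(5) msum_F by metis
  qed
  have deg_v: "mdeg (push_monomial fst v) = mdeg w" using eq(1) by simp
  have "\<exists>w'. linked F K w w' \<and> push_monomial fst w' = push_monomial fst v \<and>
      push_monomial snd w' = push_monomial snd w"
    by (rule lift_standard_relations[where P = P1 and \<sigma> = \<sigma>1 and k = k1 and f = fst and g = snd])
      (fact flag1 finite1 convex1 gen(1) k(1) w(1,2) v(2) deg_v sum(1)[symmetric] | erule (4) exchange1)+
  then obtain w1 where w1: "linked F K w w1" "push_monomial fst w1 = push_monomial fst v"
      "push_monomial snd w1 = push_monomial snd w" by blast
  have w1F: "w1 \<in> monomials F" using linked_same_image(2)[OF w1(1)] .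
  have w1_std: "standard P2 \<sigma>2 (push_monomial snd w1)" using w1(3) w(3) by simp
  have deg1: "mdeg (push_monomial snd v) = mdeg w1" using linked_same_image(3)[OF w1(1)] eq(1) by simp
  have sum1: "msum (push_monomial snd v) = msum (push_monomial snd w1)" using sum(2) w1(3) by simp
  have "\<exists>w'. linked F K w1 w' \<and> push_monomial snd w' = push_monomial snd v \<and>
      push_monomial fst w' = push_monomial fst w1"
    by (rule lift_standard_relations[where P = P2 and \<sigma> = \<sigma>2 and k = k2 and f = snd and g = fst])
      (fact flag2 finite2 convex2 gen(2) k(2) w1F w1_std v(3) deg1 sum1 | erule (4) exchange2)+
  then obtain w2 where w2: "linked F K w1 w2" "push_monomial snd w2 = push_monomial snd v"
      "push_monomial fst w2 = push_monomial fst w1" by blast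
  have "linked F K w2 v"
    using linked_same_image(2)[OF w2(1)] v(1) w1 w2 by (intro linked_same_projections k(3)) auto
  with w1(1) w2(1) show ?thesis using linked_trans by blast
qed

lemma toric_ideal_generated:
  assumes "standard_relations_generated_deg_le P1 \<sigma>1 k1" "standard_relations_generated_deg_le P2 \<sigma>2 k2"
    and "k1 \<le> K" "k2 \<le> K" "2 \<le> K"
  shows "ideal_generated_deg_le F (toric_ideal F) K"
proof (rule toric_ideal_generated_if_linked)
  fix u v assume u: "u \<in> monomials F" and v: "v \<in> monomials F" and eq: "mdeg u = mdeg v" "msum u = msum v"
  obtain u' where u': "linked F K u u'"
    "standard P1 \<sigma>1 (push_monomial fst u')" "standard P2 \<sigma>2 (push_monomial snd u')"
    using assms(5) u by (rule linked_to_standard)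
  obtain v' where v': "linked F K v v'"
    "standard P1 \<sigma>1 (push_monomial fst v')" "standard P2 \<sigma>2 (push_monomial snd v')"
    using assms(5) v by (rule linked_to_standard)
  have "linked F K u' v'"
    using linked_same_image[OF u'(1)] linked_same_image[OF v'(1)] u' v' eq
    by (intro linked_standard[OF assms]) auto
  then show "linked F K u v" using u'(1) v'(1) linked_sym linked_trans by blast
qed

end

theorem proposition1p21:
  fixes P\<^sub>1 :: "'a::euclidean_space set" and \<sigma>\<^sub>1 :: "'a \<Rightarrow> real"
    and P\<^sub>2 :: "'b::euclidean_space set" and \<sigma>\<^sub>2 :: "'b \<Rightarrow> real"
    and Q :: "'c::euclidean_space set" and \<sigma> :: "'c \<Rightarrow> real"
    and \<pi>\<^sub>1 :: "'a \<Rightarrow> 'c" and \<pi>\<^sub>2 :: "'b \<Rightarrow> 'c"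
    and F :: "('a \<times> 'b) set" and \<tau> :: "'a \<times> 'b \<Rightarrow> real"
    and k\<^sub>1 k\<^sub>2 :: nat
  assumes "is_morphism \<pi>\<^sub>1 (P\<^sub>1, \<sigma>\<^sub>1) (Q, \<sigma>)"
    and "is_morphism \<pi>\<^sub>2 (P\<^sub>2, \<sigma>\<^sub>2) (Q, \<sigma>)"
    and "flag P\<^sub>1 \<sigma>\<^sub>1" and "flag P\<^sub>2 \<sigma>\<^sub>2"
    and "unique_standard_monomials Q \<sigma>"
    and "k\<^sub>1 \<ge> 2" and "k\<^sub>2 \<ge> 2"
    and "standard_relations_generated_deg_le P\<^sub>1 \<sigma>\<^sub>1 k\<^sub>1"
    and "standard_relations_generated_deg_le P\<^sub>2 \<sigma>\<^sub>2 k\<^sub>2"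
    and "(F, \<tau>) = fiber_product \<pi>\<^sub>1 (P\<^sub>1, \<sigma>\<^sub>1) \<pi>\<^sub>2 (P\<^sub>2, \<sigma>\<^sub>2)"
  shows "ideal_generated_deg_le F (toric_ideal F) (max k\<^sub>1 k\<^sub>2)"
proof -
  interpret flag_fiber_product P\<^sub>1 \<sigma>\<^sub>1 P\<^sub>2 \<sigma>\<^sub>2 Q \<sigma> \<pi>\<^sub>1 \<pi>\<^sub>2 F \<tau>
    by unfold_locales fact+
  show ?thesis using assms(6) by (intro toric_ideal_generated[OF assms(8,9)]) auto
qed

end
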